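(* For every $X\subseteq{}^{\omega}2$ the following conditions are equivalent: (a) $X$ is null-additive. (b) For every corset $f$ there is a tree $S$ of width $f$ such that $X\subseteq(\mathrm{Lim}\,S)^{\mathrm{fin}}$. (c) For every corset $f$ there are trees $S_m$, $m<\omega$, which are almost of width $f$, such that $X\subseteq\bigcup_{m<\omega}(\mathrm{Lim}\,S_m)^{\mathrm{fin}}$. (d) For every corset $f$ there are trees $S_m$, $m<\omega$, of width $f$, such that $X\subseteq\bigcup_{m<\omega}\mathrm{Lim}\,S_m$.
   Context: ${}^{\omega}2$ is the set of infinite $0$-$1$ sequences with componentwise addition modulo 2; for $A,B\subseteq{}^\omega2$, $A+B=\{a+b:a\in A,b\in B\}$; $\mu$ is Lebesgue (fair-coin product) measure on ${}^{\omega}2$. $X\subseteq{}^{\omega}2$ is null-additive if $\mu(X+A)=0$ for every $A\subseteq{}^{\omega}2$ with $\mu(A)=0$. ${}^n2$ is the set of $0$-$1$ sequences of length $n$ and ${}^{\omega>}2=\bigcup_{n<\omega}{}^n2$. A tree is a nonempty $T\subseteq{}^{\omega>}2$ closed under initial segments such that every $\eta\in T$ has, for every $n>\mathrm{length}(\eta)$, an extension in $T$ of length $n$. $\mathrm{Lim}\,T=\{x\in{}^{\omega}2: x\restriction n\in T\text{ for every }n<\omega\}$. For $A\subseteq{}^{\omega}2$, $A^{\mathrm{fin}}=\{y\in{}^{\omega}2: \text{there is }x\in A\text{ with }x(n)=y(n)\text{ for all but finitely many }n\}$. A corset is a non-decreasing function $f:\omega\to\omega\setminus\{0\}$ which converges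 to infinity. For a corset $f$, a tree $T$ is of width $f$ if $|T\cap{}^n2|\le f(n)$ for every $n<\omega$, and almost of width $f$ if $|T\cap{}^n2|\le f(n)$ for all sufficiently large $n$. *)

theory Defs
  imports
    "HOL-Probability.Probability"
    "HOL-Library.Z2"
    "HOL-Library.Function_Algebras"
    "HOL-Library.Set_Algebras"
    "HOL-Library.Sublist"
begin

text \<open>
  The type \<^typ>\<open>bit\<close> is the field of integers modulo 2. Hence \<open>+\<close> on \<^typ>\<open>nat \<Rightarrow> bit\<close> is
  componentwise addition modulo 2, and \<open>+\<close> on \<^typ>\<open>(nat \<Rightarrow> bit) set\<close> is the set of all
  sums of elements.
\<close>

type_synonym cantor = "nat \<Rightarrow> bit"

lemma UNIV_bit: "(UNIV :: bit set) = {0, 1}"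
  by (metis (full_types) UNIV_eq_I bit_not_zero_iff insertCI)

lemma finite_UNIV_bit: "finite (UNIV :: bit set)"
  by (simp add: UNIV_bit)

text \<open>
  The completion makes every subset of a measurable null set a measurable null set, so that
  measure zero makes sense for arbitrary sets of sequences.
\<close>

definition cantor_measure :: "cantor measure" where
  "cantor_measure =
     completion (\<Pi>\<^sub>M n\<in>(UNIV :: nat set). uniform_count_measure (UNIV :: bit set))"

definition null_additive :: "cantor set \<Rightarrow> bool" where
  "null_additive X \<longleftrightarrow>
     (\<forall>A. A \<in> null_sets cantor_measure \<longrightarrow> X + A \<in> null_sets cantor_measure)"

definition tree :: "bit list set \<Rightarrow> bool" where
  "tree T \<longleftrightarrow>
     T \<noteq> {} \<and>
     (\<forall>\<eta>\<in>T. \<forall>\<nu>. prefix \<nu> \<eta> \<longrightarrow> \<nu> \<in> T) \<and>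
     (\<forall>\<eta>\<in>T. \<forall>n>length \<eta>. \<exists>\<nu>\<in>T. length \<nu> = n \<and> prefix \<eta> \<nu>)"

definition Lim_tree :: "bit list set \<Rightarrow> cantor set" where
  "Lim_tree T = {x. \<forall>n. map x [0..<n] \<in> T}"

definition fin_closure :: "cantor set \<Rightarrow> cantor set" where
  "fin_closure A = {y. \<exists>x\<in>A. \<forall>\<^sub>\<infinity>n. x n = y n}"

definition corset :: "(nat \<Rightarrow> nat) \<Rightarrow> bool" where
  "corset f \<longleftrightarrow> mono f \<and> (\<forall>n. f n \<noteq> 0) \<and> filterlim f at_top at_top"

definition level :: "bit list set \<Rightarrow> nat \<Rightarrow> bit list set" where
  "level T n = {\<eta>\<in>T. length \<eta> = n}"

lemma finite_level: "finite (level T n)"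
  using finite_lists_length_eq[OF finite_UNIV_bit, of n]
  by (auto simp: level_def intro: finite_subset[rotated])

definition of_width :: "bit list set \<Rightarrow> (nat \<Rightarrow> nat) \<Rightarrow> bool" where
  "of_width T f \<longleftrightarrow> (\<forall>n. card (level T n) \<le> f n)"

definition almost_of_width :: "bit list set \<Rightarrow> (nat \<Rightarrow> nat) \<Rightarrow> bool" where
  "almost_of_width T f \<longleftrightarrow> (\<forall>\<^sub>F n in sequentially. card (level T n) \<le> f n)"

end

theory Submission
  imports Defs "HOL-Library.Discrete_Functions"
begin

text \<open>
  Trees are replaced throughout by the sets of sequences that they carry: call \<open>Y\<close> narrow for \<open>f\<close> if
  for every \<open>n\<close> the elements of \<open>Y\<close> have at most \<open>f n\<close> initial segments of length \<open>n\<close>. The initial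
  segments of a nonempty set form a tree and a tree of width \<open>f\<close> has a narrow set of branches, so
  (d) says that \<open>X\<close> is covered by countably many narrow sets, for every corset.

  From (d) to (a). A null set \<open>A\<close> consists of sequences with infinitely many initial segments in a
  family of finite sets \<open>J n\<close> of strings of length \<open>n\<close> whose densities \<open>a n\<close> are summable. A corset \<open>f\<close>
  can grow so slowly that even \<open>f n * a n\<close> is summable. If \<open>Y\<close> is narrow for \<open>f\<close>, then a sum of an
  element of \<open>Y\<close> and an element of \<open>A\<close> has infinitely many initial segments in sets of density at
  most \<open>f n * a n\<close>, and Borel-Cantelli applies (\<open>null_additive_if_narrowly_covered\<close>).

  From (a) to (d). A counting argument (\<open>sparse_set_with_large_translates\<close>) yields, for each
  density \<open>\<epsilon>\<close>, a number \<open>k\<close> such that every large enough block of coordinates carries a set \<open>H\<close> of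
  patterns of density at most \<open>\<epsilon>\<close> of which any \<open>k\<close> distinct translates together cover half of all
  patterns. Since \<open>k\<close> does not depend on the length of the block, consecutive blocks can be chosen
  so long that the product of the \<open>k j\<close> with \<open>j \<le> n\<close> is at most the value of \<open>f\<close> at the start of block
  \<open>n\<close>. The sequences which meet infinitely many of the sets \<open>H n\<close>, of density at most \<open>2 ^ - n\<close>, form
  a null set \<open>A\<close>. If \<open>X + A\<close> is null, there is a nonempty closed set \<open>K\<close> disjoint from it without
  nonempty relatively open null parts; for \<open>x\<close> in \<open>X\<close> every point of \<open>x + K\<close> meets only finitely many
  \<open>H n\<close>. By the Baire category theorem the bound on \<open>n\<close> is uniform on a nonempty relatively open
  part \<open>B\<close> of \<open>K\<close>, and as there are countably many such parts and bounds, \<open>X\<close> splits into countably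
  many pieces on which \<open>B\<close> and the bound are constant. If a piece had more than \<open>k n\<close> patterns on
  block \<open>n\<close> for infinitely many \<open>n\<close>, then \<open>B\<close> would avoid a set of density at least one half on each
  of infinitely many disjoint blocks and so would be null (\<open>few_patterns\<close>). Hence each piece has
  at most \<open>k n\<close> patterns on almost every block, and fixing the finitely many remaining coordinates
  makes it narrow for \<open>f\<close>.

  Conditions (b) and (c) are related to (d) through finite modifications. For (b), countably
  many sets, narrow for roughly the square root of \<open>f\<close>, are merged into one: the \<open>m\<close>-th set enters
  only at a level where \<open>f\<close> has room for it. For (c), a set that is narrow from some level on is
  cut into the parts with a fixed stem up to that level.
\<close>

section \<open>Finite cubes and the coin-tossing measure\<close>

text \<open>
  Patterns on a set of coordinates are encoded as sequences that vanish outside it. Then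
  patterns on all sets of coordinates live in one group, and the pattern of a sum is the sum of
  the patterns.
\<close>

definition restr :: "nat set \<Rightarrow> cantor \<Rightarrow> cantor" where
  "restr I x = (\<lambda>i. if i \<in> I then x i else 0)"

definition cube :: "nat set \<Rightarrow> cantor set" where
  "cube I = {x. \<forall>i. i \<notin> I \<longrightarrow> x i = 0}"

lemma restr_in_cube [simp]: "restr I x \<in> cube I"
  by (simp add: restr_def cube_def)

lemma restr_restr: "restr I (restr J x) = restr (I \<inter> J) x"
  by (auto simp: restr_def)

lemma restr_eq_iff: "restr I x = restr I y \<longleftrightarrow> (\<forall>i\<in>I. x i = y i)"
  by (auto simp: restr_def fun_eq_iff)

lemma restr_add: "restr I (x + y) = restr I x + restr I y"
  by (auto simp: restr_def fun_eq_iff)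

lemma restr_Un: "I \<inter> J = {} \<Longrightarrow> restr (I \<union> J) x = restr I x + restr J x"
  by (auto simp: restr_def fun_eq_iff)

lemma restr_restr_lessThan: "m \<le> n \<Longrightarrow> restr {..<m} (restr {..<n} x) = restr {..<m} x"
  by (auto simp: restr_def)

lemma restr_lessThan_mono:
  "restr {..<n} x = restr {..<n} y \<Longrightarrow> m \<le> n \<Longrightarrow> restr {..<m} x = restr {..<m} y"
  by (simp add: restr_eq_iff)

lemma bit_add_self: "a + a = (0 :: bit)"
  by (cases a) simp_all

lemma cantor_minus: "x - y = x + (y :: cantor)"
  by (simp add: fun_eq_iff)

lemma cantor_add_self: "x + x = (0 :: cantor)"
  by (simp add: fun_eq_iff bit_add_self)

lemma cantor_add_add_self: "x + (x + y) = (y :: cantor)"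
  by (simp add: cantor_add_self flip: add.assoc)

lemma cube_add: "x \<in> cube I \<Longrightarrow> y \<in> cube I \<Longrightarrow> x + y \<in> cube I"
  by (simp add: cube_def)

lemma cube_mono: "I \<subseteq> J \<Longrightarrow> cube I \<subseteq> cube J"
  by (auto simp: cube_def)

lemma finite_card_cube:
  assumes "finite I"
  shows "finite (cube I) \<and> card (cube I) = 2 ^ card I"
proof -
  have "bij_betw (\<lambda>x. {i. x i = 1}) (cube I) (Pow I)"
  proof (rule bij_betw_byWitness[where f' = "\<lambda>A i. if i \<in> A then 1 else 0"])
    show "\<forall>x\<in>cube I. (\<lambda>i. if i \<in> {i. x i = 1} then 1 else 0) = x"
      by (auto simp: fun_eq_iff)
    show "(\<lambda>x. {i. x i = 1}) ` cube I \<subseteq> Pow I"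
      by (force simp: cube_def)
  qed (auto simp: cube_def)
  thus ?thesis using assms by (metis bij_betw_finite bij_betw_same_card card_Pow finite_Pow_iff)
qed

lemmas finite_cube = finite_card_cube[THEN conjunct1]
lemmas card_cube = finite_card_cube[THEN conjunct2]

abbreviation coin :: "cantor measure" where
  "coin \<equiv> (\<Pi>\<^sub>M n\<in>(UNIV :: nat set). uniform_count_measure (UNIV :: bit set))"

interpretation bit_space: prob_space "uniform_count_measure (UNIV :: bit set)"
  by (rule prob_space_uniform_count_measure) (simp_all add: finite_UNIV_bit)

interpretation coins: product_prob_space "\<lambda>_::nat. uniform_count_measure (UNIV :: bit set)" UNIV ..

lemma space_coin [simp]: "space coin = UNIV"
  by (simp add: space_PiM space_uniform_count_measure)

lemma restr_fibre:
  assumes "finite I" "v \<in> cube I"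
  shows "{x. restr I x = v} \<in> sets coin" "measure coin {x. restr I x = v} = 1 / 2 ^ card I"
proof -
  let ?B = "\<lambda>_::nat. uniform_count_measure (UNIV :: bit set)"
  have eq: "{x. restr I x = v} = prod_emb UNIV ?B I (PiE I (\<lambda>i. {v i}))"
    using assms(2) by (auto simp: prod_emb_def restr_def cube_def fun_eq_iff PiE_iff space_uniform_count_measure)
  show "{x. restr I x = v} \<in> sets coin"
    unfolding eq by (rule sets_PiM_I) (use assms in auto)
  have "measure coin {x. restr I x = v} = (\<Prod>i\<in>I. measure (uniform_count_measure (UNIV :: bit set)) {v i})"
    unfolding eq by (rule coins.measure_PiM_emb) (use assms in auto)
  also have "\<dots> = (\<Prod>i\<in>I. 1 / 2)"
  proof (rule prod.cong)
    fix i
    have "card (UNIV :: bit set) = 2" by (simp add: UNIV_bit)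
    thus "measure (uniform_count_measure (UNIV :: bit set)) {v i} = 1 / 2"
      using measure_uniform_count_measure[OF finite_UNIV_bit, of "{v i}"] by simp
  qed simp
  finally show "measure coin {x. restr I x = v} = 1 / 2 ^ card I" by (simp add: power_divide)
qed

lemma cylinder_union: "{x. restr I x \<in> C} = (\<Union>v\<in>C \<inter> cube I. {x. restr I x = v})"
  by auto

lemma sets_cylinder [simp]:
  assumes "finite I"
  shows "{x. restr I x \<in> C} \<in> sets coin"
  unfolding cylinder_union using finite_cube[OF assms]
  by (intro sets.finite_UN restr_fibre assms) auto

lemma measure_cylinder:
  assumes "finite I" "C \<subseteq> cube I"
  shows "measure coin {x. restr I x \<in> C} = card C / 2 ^ card I"
proof -
  have "finite C" using assms finite_cube finite_subset by blast
  have "measure coin {x. restr I x \<in> C} = measure coin (\<Union>v\<in>C. {x. restr I x = v})"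
    using assms(2) by (intro arg_cong[where f = "measure coin"]) auto
  also have "\<dots> = (\<Sum>v\<in>C. measure coin {x. restr I x = v})"
    by (rule coins.finite_measure_finite_Union)
       (use \<open>finite C\<close> assms restr_fibre in \<open>auto simp: disjoint_family_on_def\<close>)
  also have "\<dots> = (\<Sum>v\<in>C. 1 / 2 ^ card I)"
    by (rule sum.cong) (use assms restr_fibre in auto)
  finally show ?thesis by simp
qed

text \<open>
  On the union of two disjoint sets of coordinates the patterns are the sums \<open>c + d\<close> of patterns
  on the parts, in a unique way, so the counts multiply.
\<close>

lemma cylinders_independent:
  assumes I: "finite I" and J: "finite J" and disj: "I \<inter> J = {}"
  shows "measure coin {x. restr I x \<in> C \<and> restr J x \<in> D} =
         measure coin {x. restr I x \<in> C} * measure coin {x. restr J x \<in> D}"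
proof -
  define C' D' where "C' = C \<inter> cube I" and "D' = D \<inter> cube J"
  define E where "E = (\<lambda>(c, d). c + d) ` (C' \<times> D')"
  have sub: "C' \<subseteq> cube I" "D' \<subseteq> cube J" by (auto simp: C'_def D'_def)
  have split: "restr I (c + d) = c" "restr J (c + d) = d" if "c \<in> cube I" "d \<in> cube J" for c d
    using that disj by (auto simp: restr_def cube_def fun_eq_iff)
  have inj: "inj_on (\<lambda>(c, d). c + d) (C' \<times> D')"
    using sub split by (auto simp: inj_on_def) (metis subset_iff)+
  have iff: "restr (I \<union> J) x \<in> E \<longleftrightarrow> restr I x \<in> C \<and> restr J x \<in> D" for x
  proof
    assume "restr (I \<union> J) x \<in> E"
    then obtain c d where cd: "c \<in> C'" "d \<in> D'" "restr I x + restr J x = c + d"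
      by (auto simp: E_def restr_Un[OF disj])
    from cd have "restr I x = c" "restr J x = d"
      using sub split by (metis restr_in_cube subset_iff)+
    thus "restr I x \<in> C \<and> restr J x \<in> D" using cd by (auto simp: C'_def D'_def)
  next
    assume "restr I x \<in> C \<and> restr J x \<in> D"
    thus "restr (I \<union> J) x \<in> E"
      by (auto simp: E_def restr_Un[OF disj] C'_def D'_def)
  qed
  have "E \<subseteq> cube (I \<union> J)"
    using sub cube_mono[of I "I \<union> J"] cube_mono[of J "I \<union> J"] by (auto simp: E_def intro!: cube_add)
  hence "measure coin {x. restr (I \<union> J) x \<in> E} = card E / 2 ^ card (I \<union> J)"
    using I J by (intro measure_cylinder) auto
  also have "\<dots> = (card C' / 2 ^ card I) * (card D' / 2 ^ card J)"
    unfolding E_def card_image[OF inj] card_cartesian_product card_Un_disjoint[OF I J disj]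
    by (simp add: power_add)
  also have "\<dots> = measure coin {x. restr I x \<in> C'} * measure coin {x. restr J x \<in> D'}"
    using measure_cylinder[OF I sub(1)] measure_cylinder[OF J sub(2)] by simp
  finally show ?thesis unfolding iff by (simp add: C'_def D'_def)
qed

text \<open>
  These are the open sets of the product topology over the discrete two-point space.
\<close>

definition cantor_open :: "cantor set \<Rightarrow> bool" where
  "cantor_open U \<longleftrightarrow> (\<forall>x\<in>U. \<exists>n. \<forall>y. restr {..<n} y = restr {..<n} x \<longrightarrow> y \<in> U)"

text \<open>
  Outer regularity of a finite Borel measure on a Polish space, transported along the embedding
  of the 0-1 sequences into the space of real sequences.
\<close>

lemma null_set_open_superset:
  assumes "A \<in> null_sets coin" "0 < (\<epsilon>::real)"
  shows "\<exists>U. A \<subseteq> U \<and> cantor_open U \<and> U \<in> sets coin \<and> measure coin U < \<epsilon>"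
proof -
  \<comment> \<open>The embedding \<open>e\<close> and its measurable left inverse \<open>d\<close>.\<close>
  define e where "e x = (\<lambda>n. of_bool (x n = 1) :: real)" for x :: cantor
  define d where "d r = (\<lambda>n. if r n = 1 then 1 else 0 :: bit)" for r :: "nat \<Rightarrow> real"
  have de: "d (e x) = x" for x by (auto simp: d_def e_def fun_eq_iff)
  have e_meas: "e \<in> coin \<rightarrow>\<^sub>M borel"
  proof -
    have "(\<lambda>x n. of_bool (x n = 1) :: real) \<in> coin \<rightarrow>\<^sub>M (\<Pi>\<^sub>M n\<in>UNIV. borel)"
    proof (rule measurable_PiM_single')
      fix n :: nat
      have "(\<lambda>b. of_bool (b = 1) :: real) \<in> uniform_count_measure (UNIV :: bit set) \<rightarrow>\<^sub>M borel"
        by (simp add: measurable_def sets_uniform_count_measure space_uniform_count_measure)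
      thus "(\<lambda>x. of_bool (x n = 1) :: real) \<in> coin \<rightarrow>\<^sub>M borel"
        by (rule measurable_compose[rotated]) simp
    qed simp
    thus ?thesis by (simp add: e_def[abs_def] sets_PiM_equal_borel cong: measurable_cong_sets)
  qed
  have d_meas: "d \<in> borel \<rightarrow>\<^sub>M coin"
  proof -
    have "(\<lambda>r n. if r n = (1::real) then 1 else 0 :: bit) \<in> (\<Pi>\<^sub>M n\<in>UNIV. borel) \<rightarrow>\<^sub>M coin"
    proof (rule measurable_PiM_single')
      fix n :: nat
      show "(\<lambda>r. if r n = (1::real) then 1 else 0 :: bit) \<in>
              (\<Pi>\<^sub>M n\<in>UNIV. borel) \<rightarrow>\<^sub>M uniform_count_measure (UNIV :: bit set)"
        by (rule measurable_If) (simp_all add: space_uniform_count_measure)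
    qed (simp add: space_uniform_count_measure)
    thus ?thesis by (simp add: d_def[abs_def] sets_PiM_equal_borel cong: measurable_cong_sets)
  qed
  define B where "B = d -` A"
  have "A \<in> sets coin" "measure coin A = 0" using assms(1) by (auto simp: null_sets_def measure_def)
  have "B \<in> sets borel"
    using measurable_sets[OF d_meas \<open>A \<in> sets coin\<close>] by (simp add: B_def)
  have eB: "e -` B = A" by (auto simp: B_def de)
  define M where "M = distr coin borel e"
  interpret M: prob_space M unfolding M_def by (rule coins.prob_space_distr) (rule e_meas)
  have sets_M: "sets M = sets borel" by (simp add: M_def)
  have "emeasure M B = 0"
    unfolding M_def using \<open>B \<in> sets borel\<close> e_meas eB assms(1) by (simp add: emeasure_distr null_sets_def)
  moreover have "emeasure M B = (INF U \<in> {U. B \<subseteq> U \<and> open U}. emeasure M U)"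
    by (rule outer_regular) (use \<open>B \<in> sets borel\<close> sets_M in \<open>auto simp: M.emeasure_eq_measure\<close>)
  ultimately have "(INF U \<in> {U. B \<subseteq> U \<and> open U}. emeasure M U) < ennreal \<epsilon>"
    using assms(2) by simp
  then obtain G where G: "B \<subseteq> G" "open G" "emeasure M G < ennreal \<epsilon>"
    by (auto simp: INF_less_iff)
  have "emeasure M G = emeasure coin (e -` G)"
    unfolding M_def using G(2) e_meas by (simp add: emeasure_distr)
  hence "measure coin (e -` G) < \<epsilon>"
    using G(3) by (simp add: coins.emeasure_eq_measure ennreal_less_iff)
  moreover have "A \<subseteq> e -` G" using eB G(1) by blast
  moreover have "e -` G \<in> sets coin"
    using measurable_sets[OF e_meas, of G] G(2) by simp
  moreover have "cantor_open (e -` G)"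
    unfolding cantor_open_def
  proof
    fix x assume "x \<in> e -` G"
    hence "e x \<in> G" by simp
    from product_topology_open_contains_basis[OF G(2)[unfolded open_fun_def] this]
    obtain Y where Y: "e x \<in> PiE UNIV Y" "finite {i. Y i \<noteq> topspace euclidean}" "PiE UNIV Y \<subseteq> G"
      by auto
    then obtain n where n: "{i. Y i \<noteq> UNIV} \<subseteq> {..<n}"
      using finite_nat_iff_bounded by auto
    have "y \<in> e -` G" if "restr {..<n} y = restr {..<n} x" for y
    proof -
      have "e y i \<in> Y i" for i
      proof (cases "i < n")
        case True
        hence "e y i = e x i" using that by (simp add: restr_eq_iff e_def)
        thus ?thesis using Y(1) by auto
      next
        case False
        thus ?thesis using n by auto
      qed
      thus ?thesis using Y(3) by auto
    qed
    thus "\<exists>n. \<forall>y. restr {..<n} y = restr {..<n} x \<longrightarrow> y \<in> e -` G" by blast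
  qed
  ultimately show ?thesis by blast
qed

text \<open>
  An open set is the disjoint union of its maximal cylinders, so their measures sum up to its
  measure.
\<close>

lemma null_set_cylinder_cover:
  assumes "A \<in> null_sets coin" "0 < (\<epsilon>::real)"
  shows "\<exists>J. (\<forall>n. J n \<subseteq> cube {..<n}) \<and> (\<forall>x\<in>A. \<exists>n. restr {..<n} x \<in> J n) \<and>
             summable (\<lambda>n. card (J n) / 2 ^ n) \<and> (\<Sum>n. card (J n) / 2 ^ n) < \<epsilon>"
proof -
  obtain U where U: "A \<subseteq> U" "cantor_open U" "U \<in> sets coin" "measure coin U < \<epsilon>"
    using null_set_open_superset[OF assms] by blast
  define inside where "inside n v \<longleftrightarrow> (\<forall>y. restr {..<n} y = restr {..<n} v \<longrightarrow> y \<in> U)" for n v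
  \<comment> \<open>\<open>J n\<close> consists of the stems of length \<open>n\<close> of the maximal cylinders inside \<open>U\<close>.\<close>
  define J where "J n = {v \<in> cube {..<n}. inside n v \<and> (\<forall>m<n. \<not> inside m v)}" for n
  define D where "D n = {x. restr {..<n} x \<in> J n}" for n
  have inside_restr: "inside m (restr {..<n} x) \<longleftrightarrow> inside m x" if "m \<le> n" for m n x
    using that by (simp add: inside_def restr_restr_lessThan)
  have D: "D n = {x. inside n x \<and> (\<forall>m<n. \<not> inside m x)}" for n
    by (auto simp: D_def J_def inside_restr)
  have "(\<lambda>n. measure coin (D n)) sums measure coin (\<Union>n. D n)"
  proof (rule coins.finite_measure_UNION)
    show "disjoint_family D"
      unfolding disjoint_family_on_def D by (auto, metis nat_neq_iff)
  qed (auto simp: D_def)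
  moreover have "measure coin (D n) = card (J n) / 2 ^ n" for n
    unfolding D_def by (subst measure_cylinder) (auto simp: J_def)
  moreover have "(\<Union>n. D n) \<subseteq> U" by (auto simp: D inside_def)
  hence "measure coin (\<Union>n. D n) \<le> measure coin U" by (rule coins.finite_measure_mono) (rule U)
  ultimately have "summable (\<lambda>n. card (J n) / 2 ^ n)" "(\<Sum>n. card (J n) / 2 ^ n) < \<epsilon>"
    using U(4) by (auto simp: sums_iff)
  moreover have "\<exists>n. restr {..<n} x \<in> J n" if "x \<in> A" for x
  proof -
    have "\<exists>n. inside n x" using U that by (auto simp: cantor_open_def inside_def)
    hence "x \<in> D (LEAST n. inside n x)" unfolding D using not_less_Least by (auto intro: LeastI)
    thus ?thesis by (auto simp: D_def)
  qed
  moreover have "J n \<subseteq> cube {..<n}" for n by (auto simp: J_def)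
  ultimately show ?thesis by blast
qed

section \<open>Narrow sets and null-additivity\<close>

text \<open>
  With \<open>s n\<close> the square root of the \<open>n\<close>-th tail of the series, a weight of the order of \<open>1 / s n\<close>
  works: it tends to infinity, and \<open>((s n)\<^sup>2 - (s (n + 1))\<^sup>2) / s n\<close> is at most
  \<open>2 * (s n - s (n + 1))\<close>, which telescopes.
\<close>

lemma summable_with_corset_weight:
  fixes a :: "nat \<Rightarrow> real"
  assumes "\<And>n. 0 \<le> a n" "summable a"
  shows "\<exists>f. corset f \<and> summable (\<lambda>n. real (f n) * a n)"
proof -
  \<comment> \<open>Adding a geometric series keeps the tails positive when \<open>a\<close> is eventually zero.\<close>
  define b where "b n = a n + (1/2) ^ n" for n
  have b: "summable b" "\<And>n. b n > 0" "\<And>n. a n \<le> b n"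
  proof -
    have "summable (\<lambda>n. (1/2::real) ^ n)" by (rule summable_geometric) simp
    thus "summable b" unfolding b_def by (intro summable_add assms(2))
    show "b n > 0" for n unfolding b_def by (intro add_nonneg_pos assms(1)) simp
    show "a n \<le> b n" for n unfolding b_def by simp
  qed
  define s where "s n = sqrt (\<Sum>i. b (i + n))" for n
  have summ: "summable (\<lambda>i. b (i + n))" for n using b(1) by (subst summable_iff_shift)
  have pos: "0 < (\<Sum>i. b (i + n))" for n
    by (rule suminf_pos[OF summ]) (rule b(2))
  have s_pos: "s n > 0" for n using pos by (simp add: s_def)
  have step: "(s n)\<^sup>2 = b n + (s (Suc n))\<^sup>2" for n
  proof -
    have "(s k)\<^sup>2 = (\<Sum>i. b (i + k))" for k using pos[of k] by (simp add: s_def)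
    thus ?thesis using suminf_split_head[OF summ, of n] by simp
  qed
  have s_le: "s (Suc n) \<le> s n" for n
  proof (rule power2_le_imp_le)
    show "(s (Suc n))\<^sup>2 \<le> (s n)\<^sup>2" using step[of n] b(2)[of n] by linarith
  qed (use s_pos[of n] in linarith)
  have "decseq s" using s_le by (rule decseq_SucI)
  have "s \<longlonglongrightarrow> 0"
    using tendsto_real_sqrt[OF suminf_exist_split2[OF b(1)]] by (simp add: s_def[abs_def])
  define f where "f n = nat \<lfloor>1 / s n\<rfloor> + 1" for n
  have "mono f"
    unfolding f_def
  proof (intro monoI add_right_mono nat_mono floor_mono)
    fix m n :: nat assume "m \<le> n"
    thus "1 / s m \<le> 1 / s n" using s_pos \<open>decseq s\<close> by (intro divide_left_mono) (auto simp: decseq_def)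
  qed
  moreover have "filterlim f at_top at_top"
    unfolding filterlim_at_top
  proof
    fix Z :: nat
    have "\<forall>\<^sub>F n in sequentially. s n < 1 / (real Z + 1)"
      using \<open>s \<longlonglongrightarrow> 0\<close> by (rule order_tendstoD) simp
    thus "\<forall>\<^sub>F n in sequentially. Z \<le> f n"
    proof eventually_elim
      case (elim n)
      hence "real Z \<le> 1 / s n" using s_pos[of n] by (simp add: field_simps)
      thus ?case unfolding f_def by (metis le_floor_iff le_nat_floor of_int_of_nat_eq trans_le_add1)
    qed
  qed
  ultimately have "corset f" by (simp add: corset_def f_def)
  moreover have "summable (\<lambda>n. real (f n) * a n)"
  proof (rule summable_comparison_test')
    show "summable (\<lambda>n. 2 * (s n - s (Suc n)) + b n)"
      by (intro summable_add summable_mult b(1) telescope_summable'[OF \<open>s \<longlonglongrightarrow> 0\<close>])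
    fix n :: nat
    have "b n = (s n - s (Suc n)) * (s n + s (Suc n))"
      using step[of n] by (simp add: algebra_simps power2_eq_square)
    also have "\<dots> \<le> (s n - s (Suc n)) * (2 * s n)"
      using s_le[of n] by (intro mult_left_mono) auto
    finally have "b n / s n \<le> 2 * (s n - s (Suc n))" using s_pos[of n] by (simp add: field_simps)
    have "real (f n) \<le> 1 / s n + 1" using s_pos[of n] by (simp add: f_def of_nat_nat)
    hence "real (f n) * a n \<le> (1 / s n + 1) * b n"
      using b(2)[of n] b(3)[of n] assms(1)[of n] s_pos[of n] by (intro mult_mono) auto
    also have "\<dots> = b n / s n + b n" by (simp add: algebra_simps)
    also have "\<dots> \<le> 2 * (s n - s (Suc n)) + b n" using \<open>b n / s n \<le> _\<close> by simp
    finally show "norm (real (f n) * a n) \<le> 2 * (s n - s (Suc n)) + b n"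
      using assms(1)[of n] by simp
  qed
  ultimately show ?thesis by blast
qed

text \<open>
  The members of covers of total measure less than \<open>2 ^ - j\<close>, for all \<open>j\<close>, are put together. A cover
  that is this small contains no string of length \<open>j\<close> or less, so the strings that a point of \<open>A\<close>
  picks from the different covers have unbounded lengths.
\<close>

lemma null_set_limsup_cover:
  assumes "A \<in> null_sets coin"
  shows "\<exists>J. (\<forall>n. J n \<subseteq> cube {..<n}) \<and> (\<forall>x\<in>A. \<exists>\<^sub>\<infinity>n. restr {..<n} x \<in> J n) \<and>
             summable (\<lambda>n. card (J n) / 2 ^ n)"
proof -
  have "\<forall>j. \<exists>J. (\<forall>n. J n \<subseteq> cube {..<n}) \<and> (\<forall>x\<in>A. \<exists>n. restr {..<n} x \<in> J n) \<and>
             summable (\<lambda>n. card (J n) / 2 ^ n) \<and> (\<Sum>n. card (J n) / 2 ^ n) < (1/2) ^ j"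
    by (intro allI null_set_cylinder_cover assms) simp
  from choice[OF this] obtain K where
    "\<forall>j. (\<forall>n. K j n \<subseteq> cube {..<n}) \<and> (\<forall>x\<in>A. \<exists>n. restr {..<n} x \<in> K j n) \<and>
         summable (\<lambda>n. card (K j n) / 2 ^ n) \<and> (\<Sum>n. card (K j n) / 2 ^ n) < (1/2) ^ j" ..
  hence K: "\<And>j n. K j n \<subseteq> cube {..<n}" "\<And>j x. x \<in> A \<Longrightarrow> \<exists>n. restr {..<n} x \<in> K j n"
      "\<And>j. summable (\<lambda>n. card (K j n) / 2 ^ n)" "\<And>j. (\<Sum>n. card (K j n) / 2 ^ n) < (1/2) ^ j"
    by blast+
  have fin: "finite (K j n)" for j n using K(1) finite_cube finite_subset by blast
  have empty: "K j n = {}" if "n \<le> j" for j n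
  proof -
    have "card (K j n) / 2 ^ n \<le> (\<Sum>n. card (K j n) / 2 ^ n)"
      using sum_le_suminf[OF K(3), of "{n}" j] by simp
    also have "\<dots> < (1/2) ^ j" by (rule K)
    also have "\<dots> \<le> (1/2) ^ n" using that by (intro power_decreasing) auto
    finally have "card (K j n) < 1" by (simp add: field_simps power_divide)
    thus ?thesis using fin by simp
  qed
  define J where "J n = (\<Union>j<n. K j n)" for n
  have "\<exists>\<^sub>\<infinity>n. restr {..<n} x \<in> J n" if "x \<in> A" for x
    unfolding INFM_nat
  proof
    fix m
    obtain n where n: "restr {..<n} x \<in> K m n" using K(2)[OF \<open>x \<in> A\<close>] by blast
    hence "m < n" using empty[of n m] by (cases "m < n") auto
    thus "\<exists>n>m. restr {..<n} x \<in> J n" using n by (auto simp: J_def)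
  qed
  moreover have "summable (\<lambda>n. card (J n) / 2 ^ n)"
  proof (rule summableI_nonneg_bounded)
    fix N :: nat
    have "(\<Sum>n<N. card (J n) / 2 ^ n) \<le> (\<Sum>n<N. \<Sum>j<N. card (K j n) / 2 ^ n)"
    proof (rule sum_mono)
      fix n assume "n \<in> {..<N}"
      have "card (J n) \<le> (\<Sum>j<n. card (K j n))" unfolding J_def by (rule card_UN_le) simp
      also have "\<dots> \<le> (\<Sum>j<N. card (K j n))" by (rule sum_mono2) (use \<open>n \<in> _\<close> in auto)
      finally show "card (J n) / 2 ^ n \<le> (\<Sum>j<N. card (K j n) / 2 ^ n)"
        by (simp add: divide_right_mono flip: sum_divide_distrib of_nat_sum)
    qed
    also have "\<dots> = (\<Sum>j<N. \<Sum>n<N. card (K j n) / 2 ^ n)" by (rule sum.swap)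
    also have "\<dots> \<le> (\<Sum>j<N. (1/2) ^ j)"
    proof (rule sum_mono)
      fix j
      have "(\<Sum>n<N. card (K j n) / 2 ^ n) \<le> (\<Sum>n. card (K j n) / 2 ^ n)"
        by (rule sum_le_suminf[OF K(3)]) auto
      thus "(\<Sum>n<N. card (K j n) / 2 ^ n) \<le> (1/2) ^ j" using K(4)[of j] by simp
    qed
    also have "\<dots> \<le> (\<Sum>j. (1/2) ^ j)" by (rule sum_le_suminf) (auto intro: summable_geometric)
    finally show "(\<Sum>n<N. card (J n) / 2 ^ n) \<le> (\<Sum>j. (1/2) ^ j)" .
  qed simp
  moreover have "J n \<subseteq> cube {..<n}" for n using K(1) by (auto simp: J_def)
  ultimately show ?thesis by blast
qed

lemma null_sets_cantor_measure_iff: "A \<in> null_sets cantor_measure \<longleftrightarrow> (AE x in coin. x \<notin> A)"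
  unfolding cantor_measure_def null_sets_completion_iff2 eventually_ae_filter by simp

lemma AE_eventually_avoids:
  assumes I: "\<And>n. finite (I n)" and H: "\<And>n. H n \<subseteq> cube (I n)"
    and summ: "summable (\<lambda>n. card (H n) / 2 ^ card (I n))"
  shows "AE x in coin. \<forall>\<^sub>F n in sequentially. restr (I n) x \<notin> H n"
proof -
  have "AE x in coin. \<forall>\<^sub>F n in sequentially. x \<in> space coin - {x. restr (I n) x \<in> H n}"
    by (rule borel_cantelli_AE1)
       (use assms in \<open>auto simp: measure_cylinder coins.emeasure_eq_measure\<close>)
  thus ?thesis by simp
qed

definition narrow :: "(nat \<Rightarrow> nat) \<Rightarrow> cantor set \<Rightarrow> bool" where
  "narrow f Y \<longleftrightarrow> (\<forall>n. card (restr {..<n} ` Y) \<le> f n)"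

definition narrowly_covered :: "(nat \<Rightarrow> nat) \<Rightarrow> cantor set \<Rightarrow> bool" where
  "narrowly_covered f X \<longleftrightarrow> (\<exists>Y :: nat \<Rightarrow> cantor set. (\<forall>m. narrow f (Y m)) \<and> X \<subseteq> (\<Union>m. Y m))"

lemma finite_restr_image: "finite I \<Longrightarrow> finite (restr I ` Y)"
  by (rule finite_subset[OF _ finite_cube]) auto

lemma card_set_plus_le:
  assumes "finite A" "finite B"
  shows "finite (A + B)" "card (A + B) \<le> card A * card B"
proof -
  have eq: "A + B = (\<lambda>(a, b). a + b) ` (A \<times> B)" by (auto simp: set_plus_def)
  show "finite (A + B)" using assms by (simp add: eq)
  show "card (A + B) \<le> card A * card B"
    unfolding eq card_cartesian_product[symmetric] by (rule card_image_le) (use assms in simp)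
qed

text \<open>
  If \<open>Y\<close> has at most \<open>f n\<close> initial segments of length \<open>n\<close>, adding it to a set of strings of length \<open>n\<close>
  multiplies the density by at most \<open>f n\<close>. So it suffices to choose the corset against the
  densities of a given null set.
\<close>

lemma null_additive_if_narrowly_covered:
  assumes "\<And>f. corset f \<Longrightarrow> narrowly_covered f X"
  shows "null_additive X"
  unfolding null_additive_def
proof (intro allI impI)
  fix A assume "A \<in> null_sets cantor_measure"
  then obtain A' where "A' \<in> null_sets coin" "A \<subseteq> A'"
    unfolding cantor_measure_def null_sets_completion_iff2 by blast
  obtain J where "\<forall>n. J n \<subseteq> cube {..<n}" "\<forall>x\<in>A'. \<exists>\<^sub>\<infinity>n. restr {..<n} x \<in> J n"
      and J3: "summable (\<lambda>n. card (J n) / 2 ^ n)"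
    using null_set_limsup_cover[OF \<open>A' \<in> null_sets coin\<close>] by (elim exE conjE)
  hence J: "\<And>n. J n \<subseteq> cube {..<n}" "\<And>x. x \<in> A \<Longrightarrow> \<exists>\<^sub>\<infinity>n. restr {..<n} x \<in> J n"
    using \<open>A \<subseteq> A'\<close> by blast+
  obtain f where f: "corset f" "summable (\<lambda>n. real (f n) * (card (J n) / 2 ^ n))"
    using summable_with_corset_weight[OF _ J3] by auto
  obtain Y :: "nat \<Rightarrow> cantor set" where Y: "\<And>m. narrow f (Y m)" "X \<subseteq> (\<Union>m. Y m)"
    using assms[OF f(1)] unfolding narrowly_covered_def by blast
  \<comment> \<open>The possible initial segments of length \<open>n\<close> of a sum, when that of \<open>a\<close> is in \<open>J n\<close>.\<close>
  define E where "E m n = restr {..<n} ` Y m + J n" for m n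
  have finJ: "finite (J n)" for n using J(1) finite_cube finite_subset by blast
  have cardE: "card (E m n) \<le> f n * card (J n)" for m n
  proof -
    have "card (E m n) \<le> card (restr {..<n} ` Y m) * card (J n)"
      unfolding E_def by (intro card_set_plus_le finite_restr_image finJ) simp
    also have "\<dots> \<le> f n * card (J n)" using Y(1) by (simp add: narrow_def)
    finally show ?thesis .
  qed
  have "AE z in coin. \<forall>\<^sub>F n in sequentially. restr {..<n} z \<notin> E m n" for m
  proof (rule AE_eventually_avoids)
    show "E m n \<subseteq> cube {..<n}" for n
      using J(1) by (auto simp: E_def set_plus_def intro!: cube_add)
    show "summable (\<lambda>n. real (card (E m n)) / 2 ^ card {..<n})"
    proof (rule summable_comparison_test'[OF f(2)])
      fix n
      have "real (card (E m n)) \<le> real (f n * card (J n))" using cardE by (simp only: of_nat_le_iff)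
      thus "norm (real (card (E m n)) / 2 ^ card {..<n}) \<le> real (f n) * (card (J n) / 2 ^ n)"
        by (simp add: divide_right_mono)
    qed
  qed simp
  hence "AE z in coin. \<forall>m. \<forall>\<^sub>F n in sequentially. restr {..<n} z \<notin> E m n"
    by (simp add: AE_all_countable)
  hence "AE z in coin. z \<notin> X + A"
  proof eventually_elim
    case (elim z)
    show ?case
    proof
      assume "z \<in> X + A"
      then obtain x a where z: "z = x + a" "x \<in> X" "a \<in> A" by (auto simp: set_plus_def)
      then obtain m where m: "x \<in> Y m" using Y(2) by blast
      have "\<exists>\<^sub>\<infinity>n. restr {..<n} z \<in> E m n"
        using J(2)[OF z(3)] by (rule INFM_mono) (use m in \<open>auto simp: z(1) restr_add E_def\<close>)
      thus False using elim by (simp add: frequently_def cofinite_eq_sequentially)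
    qed
  qed
  thus "X + A \<in> null_sets cantor_measure" by (simp add: null_sets_cantor_measure_iff)
qed

section \<open>Trees of initial segments\<close>

lemma card_initial_segments: "card ((\<lambda>x. map x [0..<n]) ` Y) = card (restr {..<n} ` Y)"
proof -
  have "map (restr {..<n} x) [0..<n] = map x [0..<n]" for x by (simp add: restr_def)
  hence "(\<lambda>x. map x [0..<n]) ` Y = (\<lambda>v. map v [0..<n]) ` restr {..<n} ` Y"
    unfolding image_image by (intro image_cong) simp_all
  moreover have "inj_on (\<lambda>v. map v [0..<n]) (restr {..<n} ` Y)"
    by (auto simp: inj_on_def restr_def fun_eq_iff)
  ultimately show ?thesis by (simp add: card_image)
qed

definition prefix_tree :: "cantor set \<Rightarrow> bit list set" where
  "prefix_tree Y = {map x [0..<n] | x n. x \<in> Y}"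

lemma tree_prefix_tree:
  assumes "Y \<noteq> {}"
  shows "tree (prefix_tree Y)"
  unfolding tree_def
proof (intro conjI ballI allI impI)
  show "prefix_tree Y \<noteq> {}" using assms by (auto simp: prefix_tree_def)
next
  fix \<eta> \<nu> assume "\<eta> \<in> prefix_tree Y" "prefix \<nu> \<eta>"
  then obtain x n zs where x: "x \<in> Y" "\<eta> = map x [0..<n]" and "\<eta> = \<nu> @ zs"
    unfolding prefix_tree_def prefix_def by blast
  hence "\<nu> = take (length \<nu>) (map x [0..<n])" by (metis append_eq_conv_conj)
  moreover have "length \<nu> \<le> n" 
    using arg_cong[OF x(2), of length] arg_cong[OF \<open>\<eta> = \<nu> @ zs\<close>, of length] by simp
  ultimately have "\<nu> = map x [0..<length \<nu>]" by (simp add: take_map take_upt)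
  thus "\<nu> \<in> prefix_tree Y" using x(1) by (auto simp: prefix_tree_def)
next
  fix \<eta> and n assume "\<eta> \<in> prefix_tree Y" "length \<eta> < n"
  then obtain x where x: "x \<in> Y" "\<eta> = map x [0..<length \<eta>]" by (auto simp: prefix_tree_def)
  have "map x [0..<n] = map x [0..<length \<eta>] @ map x [length \<eta>..<n]"
    using upt_add_eq_append[of 0 "length \<eta>" "n - length \<eta>"] \<open>length \<eta> < n\<close> by simp
  hence "prefix \<eta> (map x [0..<n])" using x(2) by (metis prefixI)
  moreover have "map x [0..<n] \<in> prefix_tree Y" using x(1) unfolding prefix_tree_def by blast
  ultimately show "\<exists>\<nu>\<in>prefix_tree Y. length \<nu> = n \<and> prefix \<eta> \<nu>"
    by (metis length_map length_upt diff_zero)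
qed

lemma level_prefix_tree: "level (prefix_tree Y) n = (\<lambda>x. map x [0..<n]) ` Y"
  by (auto simp: level_def prefix_tree_def)

lemma of_width_prefix_tree: "of_width (prefix_tree Y) f \<longleftrightarrow> narrow f Y"
  by (simp add: of_width_def level_prefix_tree card_initial_segments narrow_def)

lemma subset_Lim_prefix_tree: "Y \<subseteq> Lim_tree (prefix_tree Y)"
  by (auto simp: Lim_tree_def prefix_tree_def)

lemma card_restr_Lim_tree: "card (restr {..<n} ` Lim_tree T) \<le> card (level T n)"
  unfolding card_initial_segments[symmetric]
  by (rule card_mono[OF finite_level]) (auto simp: level_def Lim_tree_def)

section \<open>Sparse sets with large unions of translates\<close>

text \<open>
  The set of differences \<open>u - s\<close>: the points that a set \<open>H\<close> has to avoid in order that no \<open>u\<close> from the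
  list \<open>w\<close> lies in a translate of \<open>H\<close> by an element of \<open>S\<close>.
\<close>

definition hits :: "'a::ab_group_add set \<Rightarrow> 'a list \<Rightarrow> 'a set" where
  "hits S w = (\<lambda>(u, s). u - s) ` (set w \<times> S)"

text \<open>
  The sets \<open>u - S\<close>, for \<open>u\<close> in the list, are pairwise disjoint; then for a random \<open>H\<close> the events that
  \<open>u\<close> is not covered by the translates of \<open>H\<close> are independent.
\<close>

fun separated :: "'a::ab_group_add set \<Rightarrow> 'a list \<Rightarrow> bool" where
  "separated S [] \<longleftrightarrow> True"
| "separated S (v # w) \<longleftrightarrow> (\<lambda>s. v - s) ` S \<inter> hits S w = {} \<and> separated S w"

lemma hits_Cons: "hits S (v # w) = (\<lambda>s. v - s) ` S \<union> hits S w"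
  by (auto simp: hits_def)

lemma card_hits:
  assumes "finite S" "separated S w"
  shows "card (hits S w) = length w * card S"
  using assms(2)
proof (induction w)
  case Nil
  show ?case by (simp add: hits_def)
next
  case (Cons v w)
  have "finite (hits S w)" by (auto simp: hits_def assms(1))
  moreover have "card ((\<lambda>s. v - s) ` S) = card S"
    by (rule card_image) (auto simp: inj_on_def)
  ultimately show ?case
    using Cons assms(1) by (simp add: hits_Cons card_Un_disjoint)
qed

text \<open>
  Greedy choice: a separated list of length \<open>j\<close> excludes at most \<open>j * (card S)\<^sup>2\<close> points as its next
  element, namely the sums of an already hit point and an element of \<open>S\<close>.
\<close>

lemma many_separated:
  fixes U S :: "'a::ab_group_add set"
  assumes "finite U" "finite S" "c + z * (card S)\<^sup>2 \<le> card U" "j \<le> z"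
  shows "c ^ j \<le> card {w. length w = j \<and> set w \<subseteq> U \<and> separated S w}"
  using assms(4)
proof (induction j)
  case 0
  have "{w. length w = 0 \<and> set w \<subseteq> U \<and> separated S w} = {[]}" by auto
  thus ?case by simp
next
  case (Suc j)
  let ?W = "\<lambda>j. {w. length w = j \<and> set w \<subseteq> U \<and> separated S w}"
  have fin: "finite (?W j)" for j
    by (rule finite_subset[OF _ finite_lists_length_eq[OF assms(1), of j]]) auto
  define free where "free w = U - (\<lambda>(t, s). t + s) ` (hits S w \<times> S)" for w
  have free: "c \<le> card (free w)" if "w \<in> ?W j" for w
  proof -
    have "finite (hits S w)" by (auto simp: hits_def assms(2))
    have "card ((\<lambda>(t, s). t + s) ` (hits S w \<times> S)) \<le> card (hits S w \<times> S)"
      by (rule card_image_le) (use \<open>finite (hits S w)\<close> assms(2) in auto)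
    also have "\<dots> = j * (card S)\<^sup>2"
      using that card_hits[OF assms(2), of w] by (simp add: card_cartesian_product power2_eq_square)
    also have "\<dots> \<le> z * (card S)\<^sup>2" using Suc.prems by simp
    finally have "card U - z * (card S)\<^sup>2 \<le> card U - card ((\<lambda>(t, s). t + s) ` (hits S w \<times> S))" by simp
    also have "\<dots> \<le> card (free w)" unfolding free_def
      by (rule diff_card_le_card_Diff) (use \<open>finite (hits S w)\<close> assms(2) in auto)
    finally show ?thesis using assms(3) by simp
  qed
  have "c ^ Suc j \<le> card (?W j) * c" using Suc.IH[OF Suc_leD[OF Suc.prems]] by simp
  also have "\<dots> = (\<Sum>w\<in>?W j. c)" by simp
  also have "\<dots> \<le> (\<Sum>w\<in>?W j. card (free w))" by (rule sum_mono) (rule free)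
  also have "\<dots> = card (Sigma (?W j) free)"
    using fin assms(1) by (subst card_SigmaI) (auto simp: free_def)
  also have "\<dots> \<le> card (?W (Suc j))"
  proof (rule card_inj_on_le[where f = "\<lambda>(w, v). v # w"])
    show "inj_on (\<lambda>(w, v). v # w) (Sigma (?W j) free)" by (auto simp: inj_on_def)
    show "(\<lambda>(w, v). v # w) ` Sigma (?W j) free \<subseteq> ?W (Suc j)"
    proof clarify
      fix w v assume w: "set w \<subseteq> U" "separated S w" and v: "v \<in> free w"
      have "v - s \<notin> hits S w" if "s \<in> S" for s
      proof
        assume "v - s \<in> hits S w"
        hence "(v - s) + s \<in> (\<lambda>(t, s). t + s) ` (hits S w \<times> S)" using that by blast
        thus False using v by (simp add: free_def)
      qed
      moreover have "v \<in> U" using v by (simp add: free_def)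
      ultimately show "length (v # w) = Suc (length w) \<and> set (v # w) \<subseteq> U \<and> separated S (v # w)"
        using w by auto
    qed
  qed (rule fin)
  finally show ?case .
qed

text \<open>
  The zero set of a uniformly random function from \<open>V\<close> to \<open>{..<q}\<close> is a random subset of \<open>V\<close> of
  density \<open>1 / q\<close>, which misses \<open>Y\<close> with probability \<open>(1 - 1 / q) ^ card Y\<close>.
\<close>

lemma card_functions_avoiding:
  assumes "finite V" "Y \<subseteq> V" "q \<ge> 1"
  shows "real (card {h \<in> V \<rightarrow>\<^sub>E {..<q}. \<forall>y\<in>Y. h y \<noteq> 0}) = real q ^ card V * (1 - 1 / real q) ^ card Y"
proof -
  have fY: "finite Y" using assms finite_subset by blast
  have "{h \<in> V \<rightarrow>\<^sub>E {..<q}. \<forall>y\<in>Y. h y \<noteq> 0} = PiE V (\<lambda>v. if v \<in> Y then {1..<q} else {..<q})"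
  proof (intro set_eqI iffI)
    fix h assume "h \<in> {h \<in> V \<rightarrow>\<^sub>E {..<q}. \<forall>y\<in>Y. h y \<noteq> 0}"
    thus "h \<in> PiE V (\<lambda>v. if v \<in> Y then {1..<q} else {..<q})"
      by (auto simp: PiE_iff Suc_le_eq)
  next
    fix h assume h: "h \<in> PiE V (\<lambda>v. if v \<in> Y then {1..<q} else {..<q})"
    have "h v \<in> {..<q}" "v \<in> Y \<Longrightarrow> h v \<noteq> 0" if "v \<in> V" for v
      using PiE_mem[OF h that] by (auto split: if_splits)
    thus "h \<in> {h \<in> V \<rightarrow>\<^sub>E {..<q}. \<forall>y\<in>Y. h y \<noteq> 0}"
      using h assms(2) by (auto simp: PiE_iff)
  qed
  hence "card {h \<in> V \<rightarrow>\<^sub>E {..<q}. \<forall>y\<in>Y. h y \<noteq> 0} = (\<Prod>v\<in>V. if v \<in> Y then q - 1 else q)"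
    by (simp add: card_PiE assms(1) if_distrib[of card] cong: if_cong)
  also have "real \<dots> = (\<Prod>v\<in>V. real q * (if v \<in> Y then 1 - 1 / real q else 1))"
    unfolding of_nat_prod by (rule prod.cong) (use assms(3) in \<open>auto simp: field_simps of_nat_diff\<close>)
  also have "\<dots> = real q ^ card V * (\<Prod>v\<in>V. if v \<in> Y then 1 - 1 / real q else 1)"
    by (simp add: prod.distrib)
  also have "(\<Prod>v\<in>V. if v \<in> Y then 1 - 1 / real q else 1) = (\<Prod>v\<in>V \<inter> Y. 1 - 1 / real q)"
    by (subst prod.inter_restrict[OF assms(1)]) simp
  also have "V \<inter> Y = Y" using assms(2) by blast
  finally show ?thesis by simp
qed

lemma binomial_le_pow': "n choose k \<le> n ^ k"
  by (cases "k \<le> n") (simp_all add: binomial_le_pow binomial_eq_0)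

text \<open>
  The set \<open>H\<close> is the zero set of a random function \<open>h\<close>. By Markov's inequality at least half of the
  functions have a zero set of at most twice the expected size. If each of these failed for some
  \<open>S\<close>, then it would leave more than half of \<open>V\<close> uncovered, and in the uncovered set there would be
  at least \<open>(N / 4) ^ z\<close> separated lists of length \<open>z\<close>, where \<open>N\<close> is the size of \<open>V\<close>. On the other hand
  a separated list is left uncovered with probability \<open>((1 - 1 / q) ^ k) ^ z \<le> (1 / 8) ^ z\<close>, and
  there are at most \<open>N ^ k * N ^ z\<close> pairs of a set \<open>S\<close> and a list. Counting the triples \<open>(h, S, w)\<close> in
  both ways gives \<open>2 ^ z \<le> 2 * N ^ k\<close>. Using lists instead of single points makes the failure
  probability small enough to beat the number of sets \<open>S\<close>, while \<open>k\<close> depends on \<open>q\<close> only.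
\<close>

lemma sparse_set_with_large_translates:
  fixes V :: "'a::ab_group_add set"
  assumes V: "finite V" "V \<noteq> {}" "\<And>x y. x \<in> V \<Longrightarrow> y \<in> V \<Longrightarrow> x - y \<in> V"
    and q: "q \<ge> 1" and k: "(1 - 1 / real q) ^ k \<le> 1 / 8"
    and z: "2 ^ z > 2 * card V ^ k" "4 * z * k\<^sup>2 \<le> card V"
  shows "\<exists>H\<subseteq>V. q * card H \<le> 2 * card V \<and>
           (\<forall>S\<subseteq>V. card S = k \<longrightarrow> card V \<le> 2 * card {v \<in> V. \<exists>s\<in>S. v - s \<in> H})"
proof (rule ccontr)
  assume contra: "\<not> ?thesis"
  define N where "N = card V"
  have N0: "N > 0" using V by (simp add: N_def card_gt_0_iff)
  define \<Omega> where "\<Omega> = V \<rightarrow>\<^sub>E {..<q}"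
  have fin\<Omega>: "finite \<Omega>" using V by (auto simp: \<Omega>_def intro: finite_PiE)
  have card\<Omega>: "card \<Omega> = q ^ N" using V by (simp add: \<Omega>_def card_PiE N_def)
  define Z where "Z h = {v \<in> V. h v = (0::nat)}" for h :: "'a \<Rightarrow> nat"
  define \<Omega>' where "\<Omega>' = {h \<in> \<Omega>. q * card (Z h) \<le> 2 * N}"
  have zero: "real (card {h \<in> \<Omega>. h v = 0}) = real q ^ N / real q" if "v \<in> V" for v
  proof -
    have "card {h \<in> \<Omega>. h v = 0} + card {h \<in> \<Omega>. h v \<noteq> 0} = card \<Omega>"
    proof -
      have "\<Omega> = {h \<in> \<Omega>. h v = 0} \<union> {h \<in> \<Omega>. h v \<noteq> 0}" by blast
      thus ?thesis using fin\<Omega> card_Un_disjoint[of "{h \<in> \<Omega>. h v = 0}" "{h \<in> \<Omega>. h v \<noteq> 0}"] by force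
    qed
    moreover have "real (card {h \<in> \<Omega>. h v \<noteq> 0}) = real q ^ N * (1 - 1 / real q)"
      using card_functions_avoiding[OF V(1), of "{v}" q] that q unfolding \<Omega>_def N_def by simp
    ultimately have "real (card {h \<in> \<Omega>. h v = 0}) + real q ^ N * (1 - 1 / real q) = real q ^ N"
      using card\<Omega> by (simp flip: of_nat_add of_nat_power)
    thus ?thesis by (simp add: right_diff_distrib)
  qed
  have "(\<Sum>h\<in>\<Omega>. card (Z h)) = (\<Sum>v\<in>V. card {h \<in> \<Omega>. h v = 0})"
    using sum.swap_restrict[OF fin\<Omega> V(1), of "\<lambda>_ _. 1::nat" "\<lambda>h v. h v = 0"] by (simp add: Z_def)
  hence "real (\<Sum>h\<in>\<Omega>. card (Z h)) = real N * (real q ^ N / real q)"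
    using zero by (simp add: N_def)
  hence total: "real q * real (\<Sum>h\<in>\<Omega>. card (Z h)) = real N * real q ^ N" using q by simp
  have "real (card (\<Omega> - \<Omega>')) * (2 * real N) = (\<Sum>h\<in>\<Omega> - \<Omega>'. 2 * real N)" by simp
  also have "\<dots> \<le> (\<Sum>h\<in>\<Omega> - \<Omega>'. real q * real (card (Z h)))"
  proof (rule sum_mono)
    fix h assume "h \<in> \<Omega> - \<Omega>'"
    hence "2 * N \<le> q * card (Z h)" by (auto simp: \<Omega>'_def)
    hence "real (2 * N) \<le> real (q * card (Z h))" by (simp only: of_nat_le_iff)
    thus "2 * real N \<le> real q * real (card (Z h))" by simp
  qed
  also have "\<dots> \<le> (\<Sum>h\<in>\<Omega>. real q * real (card (Z h)))"
    by (rule sum_mono2) (use fin\<Omega> in auto)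
  also have "\<dots> = real N * real q ^ N" using total by (simp add: sum_distrib_left)
  finally have "2 * real (card (\<Omega> - \<Omega>')) \<le> real q ^ N" using N0 by simp
  moreover have "card (\<Omega> - \<Omega>') = card \<Omega> - card \<Omega>'" "card \<Omega>' \<le> card \<Omega>"
    using fin\<Omega> by (auto simp: \<Omega>'_def intro!: card_Diff_subset card_mono)
  ultimately have half: "real q ^ N \<le> 2 * real (card \<Omega>')"
    using card\<Omega> by (simp add: of_nat_diff)

  define W where "W S = {w. length w = z \<and> set w \<subseteq> V \<and> separated S w}" for S :: "'a set"
  define R where "R h = {(S, w). S \<subseteq> V \<and> card S = k \<and> w \<in> W S \<and> (\<forall>y\<in>hits S w. h y \<noteq> 0)}"
    for h :: "'a \<Rightarrow> nat"
  define P where "P = {S. S \<subseteq> V \<and> card S = k} \<times> {w. set w \<subseteq> V \<and> length w = z}"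
  have finP: "finite P" unfolding P_def using V(1)
    by (intro finite_cartesian_product finite_lists_length_eq) auto
  have cardP: "card P \<le> N ^ k * N ^ z"
    unfolding P_def card_cartesian_product card_lists_length_eq[OF V(1)]
    using n_subsets[OF V(1), of k] binomial_le_pow'[of N k] by (simp add: N_def)
  have RP: "R h \<subseteq> P" for h by (auto simp: R_def P_def W_def)

  \<comment> \<open>The assumed failure of \<open>Z h\<close> supplies the set \<open>S\<close>; the lists run through the uncovered set \<open>U\<close>.\<close>
  have lower: "(real N / 4) ^ z \<le> real (card (R h))" if h: "h \<in> \<Omega>'" for h
  proof -
    have ZV: "Z h \<subseteq> V" "q * card (Z h) \<le> 2 * card V" using h by (auto simp: \<Omega>'_def Z_def N_def)
    have "\<not> (\<forall>S\<subseteq>V. card S = k \<longrightarrow> card V \<le> 2 * card {v \<in> V. \<exists>s\<in>S. v - s \<in> Z h})"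
      using contra ZV by blast
    then obtain S where S: "S \<subseteq> V" "card S = k"
      and "\<not> card V \<le> 2 * card {v \<in> V. \<exists>s\<in>S. v - s \<in> Z h}"
      by blast
    hence small: "2 * card {v \<in> V. \<exists>s\<in>S. v - s \<in> Z h} < card V" by simp
    have "finite S" using S V finite_subset by blast
    define C where "C = {v \<in> V. \<exists>s\<in>S. v - s \<in> Z h}"
    have "C \<subseteq> V" by (auto simp: C_def)
    define U where "U = V - C"
    have "card U = N - card C"
      unfolding U_def N_def using V(1) \<open>C \<subseteq> V\<close> by (intro card_Diff_subset) (auto intro: finite_subset)
    hence U: "N \<le> 2 * card U" using small by (simp add: C_def[symmetric] N_def)
    define c where "c = card U - z * k\<^sup>2"
    have "real N / 4 \<le> real c"
    proof -
      have "4 * (z * k\<^sup>2) \<le> N" using z(2) by (simp add: N_def mult.assoc)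
      hence "N \<le> 4 * c" using U by (simp add: c_def)
      thus ?thesis by simp
    qed
    hence "(real N / 4) ^ z \<le> real (c ^ z)" by (simp add: power_mono)
    also have "c ^ z \<le> card {w. length w = z \<and> set w \<subseteq> U \<and> separated S w}"
    proof (rule many_separated)
      have "z * k\<^sup>2 \<le> card U" using z(2) U by (simp add: N_def)
      thus "c + z * (card S)\<^sup>2 \<le> card U" by (simp add: c_def S)
    qed (use V \<open>finite S\<close> in \<open>auto simp: U_def\<close>)
    also have "\<dots> \<le> card (R h)"
    proof (rule card_inj_on_le[where f = "Pair S"])
      show "Pair S ` {w. length w = z \<and> set w \<subseteq> U \<and> separated S w} \<subseteq> R h"
        using S V(3) by (fastforce simp: R_def W_def U_def C_def Z_def hits_def)
      show "finite (R h)" using RP finP finite_subset by blast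
    qed (auto simp: inj_on_def)
    finally show ?thesis by simp
  qed
  \<comment> \<open>The exponent is \<open>z * k\<close> because the sets \<open>u - S\<close> along a separated list are disjoint.\<close>
  have upper: "real (card {h \<in> \<Omega>. p \<in> R h}) \<le> real q ^ N * (1 / 8) ^ z" if p: "p \<in> P" for p
  proof (cases "\<exists>h. p \<in> R h")
    case False
    thus ?thesis by simp
  next
    case True
    obtain S w where Sw: "p = (S, w)" by fastforce
    have S: "S \<subseteq> V" "card S = k" "set w \<subseteq> V" "length w = z" "separated S w"
      using True by (auto simp: R_def W_def Sw)
    have "finite S" using S V finite_subset by blast
    have hV: "hits S w \<subseteq> V" using S V(3) by (auto simp: hits_def)
    have "card {h \<in> \<Omega>. p \<in> R h} \<le> card {h \<in> V \<rightarrow>\<^sub>E {..<q}. \<forall>y\<in>hits S w. h y \<noteq> 0}"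
      by (rule card_mono) (use fin\<Omega> in \<open>auto simp: \<Omega>_def R_def Sw\<close>)
    also have "real \<dots> = real q ^ N * ((1 - 1 / real q) ^ k) ^ z"
      using card_functions_avoiding[OF V(1) hV q] card_hits[OF \<open>finite S\<close> S(5)]
      by (simp add: N_def S power_mult mult.commute)
    also have "\<dots> \<le> real q ^ N * (1 / 8) ^ z"
      by (intro mult_left_mono power_mono k) (use q in auto)
    finally show ?thesis by simp
  qed
  have "real q ^ N * (real N / 4) ^ z \<le> 2 * (real (card \<Omega>') * (real N / 4) ^ z)"
    using half by (simp add: mult_right_mono flip: mult.assoc)
  also have "real (card \<Omega>') * (real N / 4) ^ z \<le> (\<Sum>h\<in>\<Omega>'. real (card (R h)))"
    using sum_mono[OF lower] by simp
  also have "\<dots> \<le> (\<Sum>h\<in>\<Omega>. real (card (R h)))"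
    by (rule sum_mono2) (use fin\<Omega> in \<open>auto simp: \<Omega>'_def\<close>)
  also have "\<dots> = real (\<Sum>h\<in>\<Omega>. card {p \<in> P. p \<in> R h})"
    using RP by (simp add: Collect_conj_eq inf.absorb2)
  also have "(\<Sum>h\<in>\<Omega>. card {p \<in> P. p \<in> R h}) = (\<Sum>p\<in>P. card {h \<in> \<Omega>. p \<in> R h})"
    using sum.swap_restrict[OF fin\<Omega> finP, of "\<lambda>_ _. 1::nat" "\<lambda>h p. p \<in> R h"] by simp
  also have "real \<dots> \<le> (\<Sum>p\<in>P. real q ^ N * (1 / 8) ^ z)"
    unfolding of_nat_sum by (rule sum_mono) (rule upper)
  also have "\<dots> = real (card P) * (real q ^ N * (1 / 8) ^ z)" by simp
  also have "\<dots> \<le> real (N ^ k * N ^ z) * (real q ^ N * (1 / 8) ^ z)"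
    using cardP by (intro mult_right_mono) (auto simp del: of_nat_mult of_nat_power)
  finally have "real q ^ N * (real N ^ z * (1/4) ^ z) \<le> real q ^ N * (real N ^ z * (2 * real N ^ k * (1 / 8) ^ z))"
    by (simp add: power_divide field_simps)
  hence "(1/4) ^ z \<le> 2 * real N ^ k * (1 / 8) ^ z"
    using q N0 by (simp del: power_divide)
  hence "(8::real) ^ z \<le> 2 * real N ^ k * 4 ^ z" by (simp add: field_simps power_divide)
  moreover have "(8::real) ^ z = 2 ^ z * 4 ^ z" by (simp flip: power_mult_distrib)
  ultimately have "(2::real) ^ z \<le> 2 * real N ^ k" by simp
  hence "real (2 ^ z) \<le> real (2 * N ^ k)" by simp
  hence "2 ^ z \<le> 2 * N ^ k" by (simp only: of_nat_le_iff)
  thus False using z(1) by (simp add: N_def)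
qed

section \<open>Independent blocks of coordinates\<close>

text \<open>
  The lists in the counting argument have length \<open>L * k + 2\<close>, since then \<open>2 ^ (L * k + 2)\<close> exceeds
  \<open>2 * N ^ k\<close> for \<open>N = 2 ^ L\<close>. The remaining requirement that \<open>N\<close> dominates a polynomial in \<open>L\<close> holds
  for all large \<open>L\<close>; in particular \<open>k\<close> does not depend on \<open>L\<close>.
\<close>

lemma sparse_blocks_exist:
  assumes "q \<ge> 1"
  shows "\<exists>k\<ge>1. \<forall>\<^sub>F L in sequentially. \<forall>I. finite I \<longrightarrow> card I = L \<longrightarrow>
           (\<exists>H\<subseteq>cube I. q * card H \<le> 2 * 2 ^ L \<and>
             (\<forall>S\<subseteq>cube I. card S = k \<longrightarrow> 2 ^ L \<le> 2 * card {v \<in> cube I. \<exists>s\<in>S. v - s \<in> H}))"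
proof -
  have "(\<lambda>k. (1 - 1 / real q) ^ k) \<longlonglongrightarrow> 0"
    using assms by (intro LIMSEQ_realpow_zero) auto
  hence "\<forall>\<^sub>F k in sequentially. (1 - 1 / real q) ^ k < 1 / 8"
    by (rule order_tendstoD) simp
  then obtain k where k: "(1 - 1 / real q) ^ k < 1 / 8"
    by (auto simp: eventually_sequentially)
  have "k \<ge> 1" using k by (cases k) auto
  have "\<forall>\<^sub>F L in sequentially. 4 * (L * k + 2) * k\<^sup>2 \<le> 2 ^ L"
  proof -
    have "(\<lambda>L. real L / 2 ^ L) \<longlonglongrightarrow> 0" using lim_n_over_pown[of "2::real"] by simp
    moreover have "(\<lambda>L. 1 / 2 ^ L) \<longlonglongrightarrow> (0::real)"
      using LIMSEQ_realpow_zero[of "1/2::real"] by (simp add: power_divide)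
    ultimately have "(\<lambda>L. real (4 * k ^ 3) * (real L / 2 ^ L) + real (8 * k\<^sup>2) * (1 / 2 ^ L))
        \<longlonglongrightarrow> real (4 * k ^ 3) * 0 + real (8 * k\<^sup>2) * 0"
      by (intro tendsto_add tendsto_mult_left)
    hence "\<forall>\<^sub>F L in sequentially. real (4 * k ^ 3) * (real L / 2 ^ L) + real (8 * k\<^sup>2) * (1 / 2 ^ L) < 1"
      by (rule order_tendstoD) simp
    thus ?thesis
    proof eventually_elim
      case (elim L)
      hence "4 * k ^ 3 * real L + 8 * k\<^sup>2 \<le> 2 ^ L" by (simp add: field_simps)
      hence "real (4 * (L * k + 2) * k\<^sup>2) \<le> real (2 ^ L)"
        by (simp add: algebra_simps power2_eq_square power3_eq_cube)
      thus ?case by (simp only: of_nat_le_iff)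
    qed
  qed
  hence "\<forall>\<^sub>F L in sequentially. \<forall>I. finite I \<longrightarrow> card I = L \<longrightarrow>
           (\<exists>H\<subseteq>cube I. q * card H \<le> 2 * 2 ^ L \<and>
             (\<forall>S\<subseteq>cube I. card S = k \<longrightarrow> 2 ^ L \<le> 2 * card {v \<in> cube I. \<exists>s\<in>S. v - s \<in> H}))"
  proof eventually_elim
    case (elim L)
    show ?case
    proof (intro allI impI)
      fix I :: "nat set" assume I: "finite I" "card I = L"
      have card: "card (cube I) = 2 ^ L" using I card_cube by blast
      have "(2::nat) ^ (L * k + 2) > 2 * (2 ^ L) ^ k" by (simp add: power_add power_mult)
      hence "\<exists>H\<subseteq>cube I. q * card H \<le> 2 * card (cube I) \<and>
           (\<forall>S\<subseteq>cube I. card S = k \<longrightarrow> card (cube I) \<le> 2 * card {v \<in> cube I. \<exists>s\<in>S. v - s \<in> H})"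
        using elim k assms finite_cube[OF I(1)]
        by (intro sparse_set_with_large_translates[where z = "L * k + 2"])
           (auto simp: card cantor_minus cube_add intro: restr_in_cube)
      thus "\<exists>H\<subseteq>cube I. q * card H \<le> 2 * 2 ^ L \<and>
             (\<forall>S\<subseteq>cube I. card S = k \<longrightarrow> 2 ^ L \<le> 2 * card {v \<in> cube I. \<exists>s\<in>S. v - s \<in> H})"
        by (simp add: card)
    qed
  qed
  thus ?thesis using \<open>k \<ge> 1\<close> by blast
qed

definition block :: "(nat \<Rightarrow> nat) \<Rightarrow> nat \<Rightarrow> nat set" where
  "block F n = {F n..<F (Suc n)}"

lemma finite_block [simp]: "finite (block F n)"
  by (simp add: block_def)

text \<open>
  The numbers \<open>k n\<close> and sufficient block lengths \<open>L0 n\<close> are found first. Then the block boundaries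
  are pushed so far out that the corset is at least as large as the products of the \<open>k j\<close> there.
\<close>

lemma sparse_block_sequence:
  assumes "corset f"
  shows "\<exists>F k H. strict_mono F \<and> (\<forall>n. 1 \<le> k n) \<and> (\<forall>n. (\<Prod>j\<le>n. k j) \<le> f (F n)) \<and>
           (\<forall>n. H n \<subseteq> cube (block F n) \<and> 2 ^ n * card (H n) \<le> 2 ^ card (block F n) \<and>
             (\<forall>S\<subseteq>cube (block F n). card S = k n \<longrightarrow>
               2 ^ card (block F n) \<le> 2 * card {v \<in> cube (block F n). \<exists>s\<in>S. v - s \<in> H n}))"
proof -
  define P where "P n k I H \<longleftrightarrow> H \<subseteq> cube I \<and> 2 ^ n * card H \<le> 2 ^ card I \<and>
             (\<forall>S\<subseteq>cube I. card S = k \<longrightarrow> 2 ^ card I \<le> 2 * card {v \<in> cube I. \<exists>s\<in>S. v - s \<in> H})"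
    for n k :: nat and I H
  have "\<exists>k\<ge>1. \<forall>\<^sub>F L in sequentially. \<forall>I. finite I \<longrightarrow> card I = L \<longrightarrow> (\<exists>H. P n k I H)" for n
    using sparse_blocks_exist[of "2 ^ Suc n"] by (fastforce simp: P_def elim!: eventually_mono)
  hence "\<exists>k L0. k \<ge> 1 \<and> (\<forall>I. finite I \<longrightarrow> L0 \<le> card I \<longrightarrow> (\<exists>H. P n k I H))" for n
    unfolding eventually_sequentially by metis
  then obtain k L0 where k: "\<And>n. 1 \<le> k n"
    and L0: "\<And>n I. finite I \<Longrightarrow> L0 n \<le> card I \<Longrightarrow> \<exists>H. P n (k n) I H" by metis
  have large: "\<exists>m\<ge>l. b \<le> f m" for l b
  proof -
    have "\<forall>\<^sub>F m in sequentially. b \<le> f m \<and> l \<le> m"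
      using assms by (intro eventually_conj eventually_ge_at_top) (auto simp: corset_def filterlim_at_top)
    thus ?thesis by (auto simp: eventually_sequentially)
  qed
  have "\<exists>F. \<forall>n. (\<Prod>j\<le>n. k j) \<le> f (F n) \<and> F n + L0 n + 1 \<le> F (Suc n)"
    by (rule dependent_nat_choice) (use large in blast)+
  then obtain F where F: "\<And>n. (\<Prod>j\<le>n. k j) \<le> f (F n)" "\<And>n. F n + L0 n + 1 \<le> F (Suc n)" by blast
  have "strict_mono F" unfolding strict_mono_Suc_iff
  proof
    show "F n < F (Suc n)" for n using F(2)[of n] by linarith
  qed
  moreover have "\<exists>H. P n (k n) (block F n) H" for n
    using F(2)[of n] by (intro L0) (auto simp: block_def)
  then obtain H where "\<And>n. P n (k n) (block F n) (H n)" by metis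
  ultimately show ?thesis using k F(1) unfolding P_def by blast
qed

lemma independent_halves:
  assumes F: "strict_mono F" and D: "\<And>n. n \<in> Q \<Longrightarrow> D n \<subseteq> cube (block F n)"
    and half: "\<And>n. n \<in> Q \<Longrightarrow> 2 ^ card (block F n) \<le> 2 * card (D n)"
  shows "measure coin {y. \<forall>n\<in>Q. n < m \<longrightarrow> restr (block F n) y \<notin> D n} \<le> (1/2) ^ card (Q \<inter> {..<m})"
proof (induction m)
  case 0
  show ?case by simp
next
  case (Suc m)
  let ?E = "\<lambda>m. {y. \<forall>n\<in>Q. n < m \<longrightarrow> restr (block F n) y \<notin> D n}"
  show ?case
  proof (cases "m \<in> Q")
    case False
    hence "?E (Suc m) = ?E m" "Q \<inter> {..<Suc m} = Q \<inter> {..<m}" by (auto simp: less_Suc_eq)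
    thus ?thesis using Suc by simp
  next
    case True
    have earlier: "restr (block F n) (restr {..<F m} y) = restr (block F n) y" if "n < m" for n y
    proof -
      have "F (Suc n) \<le> F m" using F that by (simp add: strict_mono_less_eq)
      hence "block F n \<inter> {..<F m} = block F n" by (auto simp: block_def)
      thus ?thesis by (simp add: restr_restr)
    qed
    hence E: "?E m = {y. restr {..<F m} y \<in> ?E m}" by simp
    have "?E (Suc m) = {y. restr {..<F m} y \<in> ?E m \<and> restr (block F m) y \<in> - D m}"
      using True by (auto simp: less_Suc_eq earlier)
    hence "measure coin (?E (Suc m)) =
             measure coin {y. restr {..<F m} y \<in> ?E m} * measure coin {y. restr (block F m) y \<in> - D m}"
      by (simp only:) (rule cylinders_independent, auto simp: block_def)
    also have "\<dots> = measure coin (?E m) * measure coin {y. restr (block F m) y \<in> - D m}"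
      by (simp add: earlier)
    also have "measure coin {y. restr (block F m) y \<in> - D m} = 1 - measure coin {y. restr (block F m) y \<in> D m}"
    proof -
      have "{y. restr (block F m) y \<in> - D m} = space coin - {y. restr (block F m) y \<in> D m}" by auto
      thus ?thesis by (simp only:) (rule coins.prob_compl, simp)
    qed
    also have "\<dots> = 1 - card (D m) / 2 ^ card (block F m)"
      using D[OF True] by (simp add: measure_cylinder)
    also have "measure coin (?E m) * \<dots> \<le> (1/2) ^ card (Q \<inter> {..<m}) * (1/2)"
    proof (rule mult_mono)
      have "real (2 ^ card (block F m)) \<le> real (2 * card (D m))"
        using half[OF True] by (simp only: of_nat_le_iff)
      thus "1 - card (D m) / 2 ^ card (block F m) \<le> 1 / 2" by (simp add: field_simps)
      have "card (D m) \<le> card (cube (block F m))"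
        by (rule card_mono) (use D[OF True] finite_cube in auto)
      hence "real (card (D m)) \<le> real (2 ^ card (block F m))" by (simp add: card_cube)
      thus "0 \<le> 1 - card (D m) / 2 ^ card (block F m)" by (simp add: field_simps)
    qed (use Suc in auto)
    also have "\<dots> = (1/2) ^ card (Q \<inter> {..<Suc m})"
    proof -
      have "Q \<inter> {..<Suc m} = insert m (Q \<inter> {..<m})" using True by auto
      thus ?thesis by simp
    qed
    finally show ?thesis .
  qed
qed

text \<open>
  Otherwise \<open>k n\<close> of the patterns of \<open>Z\<close> on block \<open>n\<close> can be chosen for infinitely many \<open>n\<close>. The
  translates of \<open>H n\<close> by them cover half of the patterns and are avoided by \<open>B\<close>, so \<open>B\<close> is contained
  in an intersection of arbitrarily many independent events of probability at most one half.
\<close>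

lemma few_patterns:
  assumes F: "strict_mono F"
    and cover: "\<And>n S. S \<subseteq> cube (block F n) \<Longrightarrow> card S = k n \<Longrightarrow>
               2 ^ card (block F n) \<le> 2 * card {v \<in> cube (block F n). \<exists>s\<in>S. v - s \<in> H n}"
    and B: "B \<in> sets coin" "measure coin B > 0"
    and avoid: "\<And>x y n. x \<in> Z \<Longrightarrow> y \<in> B \<Longrightarrow> n \<ge> N \<Longrightarrow> restr (block F n) (x + y) \<notin> H n"
  shows "\<exists>M. \<forall>n\<ge>M. card (restr (block F n) ` Z) \<le> k n"
proof (rule ccontr)
  assume contra: "\<not> ?thesis"
  define Q where "Q = {n. n \<ge> N \<and> k n \<le> card (restr (block F n) ` Z)}"
  have "\<exists>n\<ge>m. n \<in> Q" for m
  proof -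
    obtain n where "n \<ge> max m N" "\<not> card (restr (block F n) ` Z) \<le> k n" using contra by blast
    thus ?thesis by (intro exI[of _ n]) (auto simp: Q_def)
  qed
  hence "infinite Q" by (simp add: infinite_nat_iff_unbounded_le)
  have "\<forall>n\<in>Q. \<exists>S. S \<subseteq> restr (block F n) ` Z \<and> card S = k n"
    by (auto simp: Q_def intro: obtain_subset_with_card_n)
  then obtain S where S: "\<And>n. n \<in> Q \<Longrightarrow> S n \<subseteq> restr (block F n) ` Z" "\<And>n. n \<in> Q \<Longrightarrow> card (S n) = k n"
    by metis
  define D where "D n = {v \<in> cube (block F n). \<exists>s\<in>S n. v - s \<in> H n}" for n
  have avoidD: "restr (block F n) y \<notin> D n" if "n \<in> Q" "y \<in> B" for n y
  proof
    assume "restr (block F n) y \<in> D n"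
    then obtain x where "x \<in> Z" "restr (block F n) y - restr (block F n) x \<in> H n"
      using S(1)[OF \<open>n \<in> Q\<close>] by (auto simp: D_def)
    hence "restr (block F n) (x + y) \<in> H n"
      by (simp add: cantor_minus restr_add add.commute)
    thus False using avoid \<open>x \<in> Z\<close> that by (simp add: Q_def)
  qed
  have "measure coin B \<le> (1/2) ^ j" for j
  proof -
    obtain T where T: "T \<subseteq> Q" "card T = j" "finite T"
      using infinite_arbitrarily_large[OF \<open>infinite Q\<close>] by blast
    obtain m where m: "T \<subseteq> {..<m}" using T(3) finite_nat_iff_bounded by blast
    let ?E = "{y. \<forall>n\<in>Q. n < m \<longrightarrow> restr (block F n) y \<notin> D n}"
    have "?E = (\<Inter>n\<in>Q \<inter> {..<m}. {y. restr (block F n) y \<in> - D n}) \<inter> space coin" by auto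
    also have "\<dots> \<in> sets coin"
      using sets.top[of coin]
      by (cases "Q \<inter> {..<m} = {}") (auto intro!: sets.Int sets.finite_INT simp del: Compl_iff)
    finally have "measure coin B \<le> measure coin ?E"
      by (intro coins.finite_measure_mono) (use avoidD in auto)
    also have "\<dots> \<le> (1/2) ^ card (Q \<inter> {..<m})"
    proof (rule independent_halves[OF F])
      show "2 ^ card (block F n) \<le> 2 * card (D n)" if "n \<in> Q" for n
        unfolding D_def
      proof (rule cover)
        show "S n \<subseteq> cube (block F n)" using S(1)[OF that] by (rule subset_trans) auto
      qed (rule S(2)[OF that])
    qed (auto simp: D_def)
    also have "\<dots> \<le> (1/2) ^ j"
      using T m by (intro power_decreasing) (auto intro!: card_mono)
    finally show ?thesis .
  qed
  moreover have "(\<lambda>j. (1/2::real) ^ j) \<longlonglongrightarrow> 0" by (rule LIMSEQ_realpow_zero) auto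
  ultimately have "measure coin B \<le> 0" by (intro LIMSEQ_le_const) auto
  thus False using B(2) by simp
qed

section \<open>Closed sets of positive measure and category\<close>

text \<open>
  Outside an open superset of \<open>N\<close> of measure less than 1, all cylinders which meet that complement
  in a null set are removed as well. As there are countably many cylinders, this costs nothing,
  and every point that remains has only neighbourhoods of positive measure in \<open>K\<close>.
\<close>

lemma positive_kernel:
  assumes "N \<in> null_sets coin"
  shows "\<exists>K. K \<noteq> {} \<and> K \<inter> N = {} \<and> cantor_open (- K) \<and> K \<in> sets coin \<and>
           (\<forall>x\<in>K. \<forall>n. measure coin {y \<in> K. restr {..<n} y = restr {..<n} x} > 0)"
proof -
  obtain U where U: "N \<subseteq> U" "cantor_open U" "U \<in> sets coin" "measure coin U < 1"
    using null_set_open_superset[OF assms, of 1] by auto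
  define cyl where "cyl n v = {y. restr {..<n} y = v}" for n v
  have cyl: "cyl n v \<in> sets coin" for n v
    using sets_cylinder[of "{..<n}" "{v}"] by (simp add: cyl_def)
  define V where "V n = {v \<in> cube {..<n}. measure coin (cyl n v - U) = 0}" for n
  define W where "W = (\<Union>n. \<Union>v\<in>V n. cyl n v)"
  have finV: "finite (V n)" for n
    unfolding V_def using finite_cube[of "{..<n}"] by simp
  have "cyl n v - U \<in> null_sets coin" if "v \<in> V n" for n v
    using that cyl U(3) by (auto simp: V_def null_sets_def coins.emeasure_eq_measure)
  hence "(\<Union>v\<in>V n. cyl n v - U) \<in> null_sets coin" for n
    by (intro null_sets_UN'[OF countable_finite[OF finV]])
  hence *: "(\<Union>n. \<Union>v\<in>V n. cyl n v - U) \<in> null_sets coin" by (rule null_sets_UN)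
  have null: "W - U \<in> null_sets coin" 
  proof -
    have "W - U = (\<Union>n. \<Union>v\<in>V n. cyl n v - U)" by (auto simp: W_def)
    thus ?thesis using * by simp
  qed
  have setsW: "W \<in> sets coin"
    unfolding W_def using finV cyl by (intro sets.countable_UN' sets.finite_UN) auto
  define K where "K = - (U \<union> W)"
  have setsK: "K \<in> sets coin"
  proof -
    have "space coin - (U \<union> W) \<in> sets coin" by (intro sets.Diff sets.top sets.Un U setsW)
    moreover have "space coin - (U \<union> W) = K" by (auto simp: K_def)
    ultimately show ?thesis by (simp only:)
  qed
  have "cantor_open (- K)"
    unfolding cantor_open_def
  proof
    fix x assume "x \<in> - K"
    then consider "x \<in> U" | n where "restr {..<n} x \<in> V n"
      by (auto simp: K_def W_def cyl_def)
    thus "\<exists>n. \<forall>y. restr {..<n} y = restr {..<n} x \<longrightarrow> y \<in> - K"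
    proof cases
      case 1
      then obtain n where "\<forall>y. restr {..<n} y = restr {..<n} x \<longrightarrow> y \<in> U"
        using U(2) unfolding cantor_open_def by blast
      thus ?thesis unfolding K_def by blast
    next
      case 2
      have "y \<in> - K" if "restr {..<n} y = restr {..<n} x" for y
      proof -
        have "y \<in> cyl n (restr {..<n} x)" using that by (simp add: cyl_def)
        hence "y \<in> W" using 2 unfolding W_def by blast
        thus ?thesis by (simp add: K_def)
      qed
      thus ?thesis by blast
    qed
  qed
  moreover have "K \<noteq> {}"
  proof
    assume "K = {}"
    hence "space coin = U \<union> (W - U)" unfolding K_def space_coin by blast
    hence "measure coin (space coin) = measure coin (U \<union> (W - U))" by (rule arg_cong)
    also have "\<dots> = measure coin U"
      using U(3) null by (rule measure_Un_null_set)
    finally have "1 = measure coin U" unfolding coins.P.prob_space .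
    thus False using U(4) by simp
  qed
  moreover have "measure coin {y \<in> K. restr {..<n} y = restr {..<n} x} > 0" if "x \<in> K" for x n
  proof (rule ccontr)
    let ?v = "restr {..<n} x"
    have eq: "{y \<in> K. restr {..<n} y = ?v} = (cyl n ?v - U) - (W - U)" unfolding K_def cyl_def by blast
    assume "\<not> ?thesis"
    hence "measure coin {y \<in> K. restr {..<n} y = ?v} = 0"
      using measure_nonneg[of coin "{y \<in> K. restr {..<n} y = ?v}"] by linarith
    hence "measure coin (cyl n ?v - U) = 0"
      unfolding eq using measure_Diff_null_set[OF _ null, of "cyl n ?v - U"] cyl[of n ?v] U(3) by simp
    hence "?v \<in> V n" by (simp add: V_def)
    moreover have "x \<in> cyl n ?v" by (simp add: cyl_def)
    ultimately have "x \<in> W" unfolding W_def by blast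
    thus False using that by (simp add: K_def)
  qed
  moreover have "K \<inter> N = {}" using U(1) by (auto simp: K_def)
  ultimately show ?thesis using setsK by blast
qed

text \<open>
  The Baire category theorem for a closed set \<open>K\<close>. If no \<open>C N\<close> contained a nonempty relatively open
  part of \<open>K\<close>, one could pass from any point of \<open>K\<close> to a point of \<open>K\<close> with a long common initial
  segment and a whole neighbourhood outside \<open>C N\<close>; the points so obtained for \<open>N = 0, 1, \<dots>\<close> converge
  to a point of \<open>K\<close> outside all \<open>C N\<close>.
\<close>

lemma closed_cover_Baire:
  assumes K: "K \<noteq> {}" "cantor_open (- K)"
    and C: "\<And>N :: nat. cantor_open (- C N)" and cover: "K \<subseteq> (\<Union>N. C N)"
  shows "\<exists>N n. \<exists>x\<in>K. {y \<in> K. restr {..<n} y = restr {..<n} x} \<subseteq> C N"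
proof (rule ccontr)
  assume contra: "\<not> ?thesis"
  \<comment> \<open>A pair consists of a point and the length up to which all later points agree with it.\<close>
  define R where "R N p p' \<longleftrightarrow> snd p < snd p' \<and> restr {..<snd p} (fst p') = restr {..<snd p} (fst p) \<and>
      (\<forall>y. restr {..<snd p'} y = restr {..<snd p'} (fst p') \<longrightarrow> y \<notin> C N)"
    for N and p p' :: "cantor \<times> nat"
  have ex: "\<exists>p'. fst p' \<in> K \<and> R N p p'" if p: "fst p \<in> K" for N p
  proof -
    have "\<not> {y \<in> K. restr {..<snd p} y = restr {..<snd p} (fst p)} \<subseteq> C N"
      using contra p by blast
    then obtain y where y: "y \<in> K" "restr {..<snd p} y = restr {..<snd p} (fst p)" "y \<notin> C N"
      by blast
    then obtain n where n: "\<And>z. restr {..<n} z = restr {..<n} y \<Longrightarrow> z \<notin> C N"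
      using C[of N] by (auto simp: cantor_open_def)
    define n' where "n' = max n (Suc (snd p))"
    have "z \<notin> C N" if "restr {..<n'} z = restr {..<n'} y" for z
      using n restr_lessThan_mono[OF that, of n] by (simp add: n'_def)
    moreover have "snd p < n'" by (simp add: n'_def)
    ultimately have "R N p (y, n')" using y(2) unfolding R_def fst_conv snd_conv by blast
    thus ?thesis using y(1) by (intro exI[of _ "(y, n')"]) simp
  qed
  obtain x0 where "x0 \<in> K" using K(1) by blast
  hence "\<exists>p :: cantor \<times> nat. fst p \<in> K" by (intro exI[of _ "(x0, 0)"]) simp
  from dependent_nat_choice[of "\<lambda>_ p. fst p \<in> K" R, OF this ex]
  have "\<exists>P. \<forall>N. fst (P N) \<in> K \<and> R N (P N) (P (Suc N))" .
  then obtain P where P: "\<And>N. fst (P N) \<in> K" "\<And>N. R N (P N) (P (Suc N))" by blast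
  define x n where "x N = fst (P N)" and "n N = snd (P N)" for N
  have n: "strict_mono n" unfolding strict_mono_Suc_iff using P(2) by (simp add: R_def n_def)
  have x_step: "restr {..<n N} (x (Suc N)) = restr {..<n N} (x N)" for N
    using P(2)[of N] by (simp add: R_def n_def x_def)
  have x_agree: "restr {..<n N} (x M) = restr {..<n N} (x N)" if "N \<le> M" for N M
    using that
  proof (induction rule: dec_induct)
    case (step M)
    have "n N \<le> n M" using n step by (simp add: strict_mono_less_eq)
    thus ?case using restr_lessThan_mono[OF x_step] step by metis
  qed simp
  \<comment> \<open>By stage \<open>i + 1\<close> the coordinate \<open>i\<close> is fixed, as the lengths \<open>n N\<close> are strictly increasing.\<close>
  define z where "z i = x (Suc i) i" for i
  have z: "restr {..<n N} z = restr {..<n N} (x N)" for N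
    unfolding restr_eq_iff
  proof
    fix i assume "i \<in> {..<n N}"
    have "i < n (Suc i)" using strict_mono_imp_increasing[OF n, of "Suc i"] by simp
    show "z i = x N i"
    proof (cases "N \<le> Suc i")
      case True
      thus ?thesis using x_agree[of N "Suc i"] \<open>i \<in> _\<close> by (simp add: z_def restr_eq_iff)
    next
      case False
      thus ?thesis using x_agree[of "Suc i" N] \<open>i < n (Suc i)\<close> by (simp add: z_def restr_eq_iff)
    qed
  qed
  have "z \<in> K"
  proof (rule ccontr)
    assume "z \<notin> K"
    then obtain m where m: "\<And>y. restr {..<m} y = restr {..<m} z \<Longrightarrow> y \<notin> K"
      using K(2) by (auto simp: cantor_open_def)
    have "restr {..<m} (x m) = restr {..<m} z"
      using restr_lessThan_mono[OF z[of m], of m] strict_mono_imp_increasing[OF n, of m] by simp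
    thus False using m P(1)[of m] by (simp add: x_def)
  qed
  then obtain N where "z \<in> C N" using cover by blast
  thus False using P(2)[of N] z[of "Suc N"] by (auto simp: R_def x_def n_def)
qed

section \<open>From null-additivity to narrow covers\<close>

lemma narrowly_coveredI:
  assumes "countable \<Y>" "\<And>Y. Y \<in> \<Y> \<Longrightarrow> narrow f Y" "X \<subseteq> \<Union>\<Y>"
  shows "narrowly_covered f X"
proof -
  have "range (from_nat_into (insert {} \<Y>)) = insert {} \<Y>"
    using assms(1) by (intro range_from_nat_into) auto
  moreover have "narrow f {}" by (simp add: narrow_def)
  ultimately show ?thesis
    unfolding narrowly_covered_def using assms(2,3)
    by (intro exI[of _ "from_nat_into (insert {} \<Y>)"])
      (metis (no_types, lifting) UnionI Union_insert insert_iff rangeI sup_bot_left)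
qed

lemma narrowly_covered_UN:
  assumes "countable C" "\<And>i. i \<in> C \<Longrightarrow> narrowly_covered f (Z i)" "X \<subseteq> (\<Union>i\<in>C. Z i)"
  shows "narrowly_covered f X"
proof -
  obtain Y :: "_ \<Rightarrow> nat \<Rightarrow> cantor set"
    where Y: "\<And>i m. i \<in> C \<Longrightarrow> narrow f (Y i m)" "\<And>i. i \<in> C \<Longrightarrow> Z i \<subseteq> (\<Union>m. Y i m)"
    using assms(2) unfolding narrowly_covered_def by metis
  show ?thesis
  proof (rule narrowly_coveredI)
    show "countable (\<Union>i\<in>C. range (Y i))" using assms(1) by auto
    show "X \<subseteq> \<Union>(\<Union>i\<in>C. range (Y i))" using assms(3) Y(2) by fastforce
  qed (use Y(1) in auto)
qed

lemma countable_finite_support: "countable (\<Union>n. cube {..<n})"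
  by (rule countable_UN) (auto intro: countable_finite finite_cube)

lemma card_restr_mono: "m \<le> n \<Longrightarrow> card (restr {..<m} ` Y) \<le> card (restr {..<n} ` Y)"
proof -
  assume "m \<le> n"
  hence "restr {..<m} ` Y = restr {..<m} ` restr {..<n} ` Y"
    by (simp add: image_image restr_restr_lessThan)
  thus ?thesis by (metis card_image_le finite_lessThan finite_restr_image)
qed

text \<open>
  Beyond the single stem up to \<open>F M\<close>, an initial segment ending at a block boundary is determined
  by its patterns on the blocks. Inside block \<open>i\<close> the number of initial segments is bounded by the
  count at the end of the block, which is at most \<open>f (F i)\<close>, the value of the corset at its start.
\<close>

lemma narrow_if_few_patterns:
  assumes F: "strict_mono F" and f: "corset f"
    and k: "\<And>n. 1 \<le> k n" "\<And>n. (\<Prod>j\<le>n. k j) \<le> f (F n)"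
    and few: "\<And>n. n \<ge> M \<Longrightarrow> card (restr (block F n) ` Y) \<le> k n"
    and stem: "card (restr {..<F M} ` Y) \<le> 1"
  shows "narrow f Y"
proof -
  have prod: "card (restr {..<F n} ` Y) \<le> (\<Prod>j\<in>{M..<n}. k j)" if "M \<le> n" for n
    using that
  proof (induction rule: dec_induct)
    case base
    show ?case using stem by simp
  next
    case (step n)
    have "F n \<le> F (Suc n)" using F by (simp add: strict_mono_less_eq)
    hence "restr {..<F (Suc n)} x = restr {..<F n} x + restr (block F n) x" for x
      by (subst restr_Un[symmetric]) (auto simp: block_def ivl_disj_un)
    hence "restr {..<F (Suc n)} ` Y \<subseteq> restr {..<F n} ` Y + restr (block F n) ` Y"
      by (auto simp: set_plus_def)
    hence "card (restr {..<F (Suc n)} ` Y) \<le> card (restr {..<F n} ` Y + restr (block F n) ` Y)"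
      by (intro card_mono card_set_plus_le finite_restr_image) auto
    also have "\<dots> \<le> card (restr {..<F n} ` Y) * card (restr (block F n) ` Y)"
      by (intro card_set_plus_le finite_restr_image) auto
    also have "\<dots> \<le> (\<Prod>j\<in>{M..<n}. k j) * k n"
      using step few by (intro mult_le_mono) auto
    also have "\<dots> = (\<Prod>j\<in>{M..<Suc n}. k j)" using step by simp
    finally show ?case .
  qed
  show ?thesis
    unfolding narrow_def
  proof
    fix n
    show "card (restr {..<n} ` Y) \<le> f n"
    proof (cases "n \<le> F M")
      case True
      have "card (restr {..<n} ` Y) \<le> 1" using card_restr_mono[OF True, of Y] stem by linarith
      also have "1 \<le> f n" using f by (simp add: corset_def Suc_le_eq)
      finally show ?thesis .
    next
      case False
      define j where "j = (LEAST j. n \<le> F j)"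
      have "n \<le> F n" using strict_mono_imp_increasing[OF F] .
      hence j: "n \<le> F j" unfolding j_def by (rule LeastI)
      have "M < j"
      proof (rule ccontr)
        assume "\<not> M < j"
        hence "F j \<le> F M" using F by (simp add: strict_mono_less_eq)
        thus False using False j by simp
      qed
      then obtain i where i: "j = Suc i" "M \<le> i" by (cases j) auto
      have "F i < n" using not_less_Least[of i "\<lambda>j. n \<le> F j"] i by (simp add: j_def not_le)
      have "card (restr {..<n} ` Y) \<le> card (restr {..<F j} ` Y)" using j by (rule card_restr_mono)
      also have "\<dots> \<le> (\<Prod>l\<in>{M..<j}. k l)" using \<open>M < j\<close> by (intro prod) simp
      also have "\<dots> \<le> (\<Prod>l\<le>i. k l)"
      proof (rule dvd_imp_le)
        show "(\<Prod>l\<in>{M..<j}. k l) dvd (\<Prod>l\<le>i. k l)"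
          by (rule prod_dvd_prod_subset) (use i in auto)
        show "0 < (\<Prod>l\<le>i. k l)" using k(1) by (auto simp: Suc_le_eq intro!: prod_pos)
      qed
      also have "\<dots> \<le> f (F i)" by (rule k)
      also have "\<dots> \<le> f n" using f \<open>F i < n\<close> by (simp add: corset_def monoD)
      finally show ?thesis .
    qed
  qed
qed

text \<open>
  The null set \<open>A\<close> consists of the sequences with infinitely many block patterns in the sparse
  sets \<open>H n\<close>, and \<open>K\<close> is a closed set disjoint from \<open>X + A\<close> all of whose nonempty relatively open
  parts have positive measure. As sums are taken modulo 2, \<open>x + y \<in> A\<close> would put \<open>y = x + (x + y)\<close>
  into \<open>X + A\<close>; hence \<open>x + y \<notin> A\<close> for \<open>x \<in> X\<close> and \<open>y \<in> K\<close>.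
\<close>

lemma narrowly_covered_if_null_additive:
  assumes "null_additive X" "corset f"
  shows "narrowly_covered f X"
proof -
  obtain F k H where F: "strict_mono F" and k: "\<And>n. 1 \<le> k n" "\<And>n. (\<Prod>j\<le>n. k j) \<le> f (F n)"
    and H: "\<And>n. H n \<subseteq> cube (block F n)" "\<And>n. 2 ^ n * card (H n) \<le> 2 ^ card (block F n)"
    and cover: "\<And>n S. S \<subseteq> cube (block F n) \<Longrightarrow> card S = k n \<Longrightarrow>
               2 ^ card (block F n) \<le> 2 * card {v \<in> cube (block F n). \<exists>s\<in>S. v - s \<in> H n}"
    using sparse_block_sequence[OF assms(2)] by (elim exE conjE) blast
  define A where "A = {z. \<exists>\<^sub>\<infinity>n. restr (block F n) z \<in> H n}"
  have "AE z in coin. \<forall>\<^sub>F n in sequentially. restr (block F n) z \<notin> H n"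
  proof (rule AE_eventually_avoids)
    show "summable (\<lambda>n. real (card (H n)) / 2 ^ card (block F n))"
    proof (rule summable_comparison_test')
      show "summable (\<lambda>n. (1/2::real) ^ n)" by (rule summable_geometric) simp
      fix n
      have "real (2 ^ n * card (H n)) \<le> real (2 ^ card (block F n))"
        using H(2)[of n] by (simp only: of_nat_le_iff)
      thus "norm (real (card (H n)) / 2 ^ card (block F n)) \<le> (1/2) ^ n"
        by (simp add: field_simps power_divide)
    qed
  qed (use H in auto)
  hence "A \<in> null_sets cantor_measure"
    unfolding null_sets_cantor_measure_iff
    by eventually_elim (simp add: A_def frequently_def cofinite_eq_sequentially)
  hence "X + A \<in> null_sets cantor_measure" using assms(1) by (simp add: null_additive_def)
  then obtain N where "N \<in> null_sets coin" "X + A \<subseteq> N"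
    unfolding cantor_measure_def null_sets_completion_iff2 by blast
  from positive_kernel[OF this(1)] obtain K where K: "K \<noteq> {}" "K \<inter> N = {}" "cantor_open (- K)" "K \<in> sets coin"
    and pos: "\<And>x n. x \<in> K \<Longrightarrow> measure coin {y \<in> K. restr {..<n} y = restr {..<n} x} > 0"
    by (elim exE conjE) blast
  \<comment> \<open>The relatively open parts of \<open>K\<close>, and the pieces of \<open>X\<close> that belong to such a part
    and a bound \<open>m\<close> from which on all patterns are avoided.\<close>
  define B where "B p w = {y \<in> K. restr {..<p} y = w}" for p w
  define Z where "Z = (\<lambda>(m, p, w). {x \<in> X. \<forall>y\<in>B p w. \<forall>n\<ge>m. restr (block F n) (x + y) \<notin> H n})"
  define I where "I = {(m :: nat, p, w). w \<in> (\<Union>n. cube {..<n}) \<and> measure coin (B p w) > 0}"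
  show ?thesis
  proof (rule narrowly_covered_UN)
    have "I \<subseteq> UNIV \<times> UNIV \<times> (\<Union>n. cube {..<n})" by (auto simp: I_def)
    thus "countable I"
      by (rule countable_subset) (intro countable_SIGMA countable_finite_support, auto)
  next
    show "X \<subseteq> (\<Union>i\<in>I. Z i)"
    proof
      fix x assume "x \<in> X"
      define C where "C m = {y. \<forall>n\<ge>m. restr (block F n) (x + y) \<notin> H n}" for m
      have "cantor_open (- C m)" for m
        unfolding cantor_open_def
      proof
        fix y assume "y \<in> - C m"
        then obtain n where n: "n \<ge> m" "restr (block F n) (x + y) \<in> H n" by (auto simp: C_def)
        have "z \<in> - C m" if "restr {..<F (Suc n)} z = restr {..<F (Suc n)} y" for z
        proof -
          have "restr (block F n) z = restr (block F n) y"
            using that by (auto simp: restr_eq_iff block_def)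
          hence "restr (block F n) (x + z) \<in> H n" using n(2) by (simp add: restr_add)
          thus ?thesis using n(1) by (auto simp: C_def)
        qed
        thus "\<exists>n. \<forall>z. restr {..<n} z = restr {..<n} y \<longrightarrow> z \<in> - C m" by blast
      qed
      moreover have "K \<subseteq> (\<Union>m. C m)"
      proof
        fix y assume "y \<in> K"
        have "x + y \<notin> A"
        proof
          assume "x + y \<in> A"
          hence "x + (x + y) \<in> X + A" using \<open>x \<in> X\<close> by (rule set_plus_intro[rotated])
          thus False using \<open>X + A \<subseteq> N\<close> K(2) \<open>y \<in> K\<close> by (auto simp: cantor_add_add_self)
        qed
        thus "y \<in> (\<Union>m. C m)"
          by (auto simp: A_def C_def frequently_def cofinite_eq_sequentially eventually_sequentially)
      qed
      ultimately obtain m p u where u: "u \<in> K" "B p (restr {..<p} u) \<subseteq> C m"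
        using closed_cover_Baire[OF K(1,3), of C] unfolding B_def by blast
      have "restr {..<p} u \<in> (\<Union>n. cube {..<n})" by (rule UN_I[of p]) simp_all
      hence "(m, p, restr {..<p} u) \<in> I"
        using pos[OF u(1), of p] by (simp add: I_def B_def)
      moreover have "x \<in> Z (m, p, restr {..<p} u)" using u(2) \<open>x \<in> X\<close> by (auto simp: Z_def C_def)
      ultimately show "x \<in> (\<Union>i\<in>I. Z i)" by blast
    qed
  next
    fix i assume "i \<in> I"
    then obtain m p w where i: "i = (m, p, w)" and B: "measure coin (B p w) > 0" by (auto simp: I_def)
    have "B p w = K \<inter> {y. restr {..<p} y \<in> {w}}" by (auto simp: B_def)
    hence "B p w \<in> sets coin" using K(4) sets_cylinder[of "{..<p}" "{w}"] by (simp only: sets.Int finite_lessThan)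
    then obtain M where M: "\<And>n. n \<ge> M \<Longrightarrow> card (restr (block F n) ` Z i) \<le> k n"
      using few_patterns[where F = F and k = k and H = H and B = "B p w" and Z = "Z i" and N = m] F cover B by (auto simp: Z_def i)
    show "narrowly_covered f (Z i)"
    proof (rule narrowly_coveredI)
      let ?\<Y> = "(\<lambda>w. {x \<in> Z i. restr {..<F M} x = w}) ` cube {..<F M}"
      show "countable ?\<Y>" by (intro countable_image countable_finite finite_cube) simp
      show "Z i \<subseteq> \<Union>?\<Y>" by auto
      fix Y assume "Y \<in> ?\<Y>"
      then obtain w where Y: "Y = {x \<in> Z i. restr {..<F M} x = w}" by blast
      show "narrow f Y"
      proof (rule narrow_if_few_patterns[OF F assms(2) k])
        fix n assume "n \<ge> M"
        have "card (restr (block F n) ` Y) \<le> card (restr (block F n) ` Z i)"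
          by (intro card_mono finite_restr_image) (auto simp: Y)
        thus "card (restr (block F n) ` Y) \<le> k n" using M[OF \<open>n \<ge> M\<close>] by linarith
      next
        have "restr {..<F M} ` Y \<subseteq> {w}" by (auto simp: Y)
        thus "card (restr {..<F M} ` Y) \<le> 1" using card_mono[of "{w}"] by fastforce
      qed
    qed
  qed
qed

section \<open>The equivalence\<close>

text \<open>
  A tree is nonempty, so for empty \<open>Y\<close> the tree of initial segments of a single sequence is used.
\<close>

lemma narrow_subset_Lim_tree:
  assumes "corset f" "narrow f Y"
  shows "\<exists>S. tree S \<and> of_width S f \<and> Y \<subseteq> Lim_tree S"
proof (cases "Y = {}")
  case True
  have "narrow f {0}" using assms(1) by (simp add: narrow_def corset_def Suc_le_eq)
  thus ?thesis using True tree_prefix_tree[of "{0}"]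
    by (intro exI[of _ "prefix_tree {0}"]) (simp add: of_width_prefix_tree)
next
  case False
  thus ?thesis using assms(2) tree_prefix_tree subset_Lim_prefix_tree
    by (intro exI[of _ "prefix_tree Y"]) (simp add: of_width_prefix_tree)
qed

lemma narrowly_covered_iff_trees:
  assumes "corset f"
  shows "narrowly_covered f X \<longleftrightarrow>
           (\<exists>S :: nat \<Rightarrow> bit list set. (\<forall>m. tree (S m) \<and> of_width (S m) f) \<and> X \<subseteq> (\<Union>m. Lim_tree (S m)))"
    (is "_ \<longleftrightarrow> ?trees")
proof
  assume "narrowly_covered f X"
  then obtain Y where Y: "\<And>m :: nat. narrow f (Y m)" "X \<subseteq> (\<Union>m. Y m)"
    unfolding narrowly_covered_def by blast
  obtain S where S: "\<And>m. tree (S m) \<and> of_width (S m) f \<and> Y m \<subseteq> Lim_tree (S m)"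
    using narrow_subset_Lim_tree[OF assms Y(1)] by metis
  have "X \<subseteq> (\<Union>m. Lim_tree (S m))" using Y(2) S by blast
  thus ?trees using S by blast
next
  assume ?trees
  then obtain S :: "nat \<Rightarrow> bit list set"
    where S: "\<And>m. of_width (S m) f" "X \<subseteq> (\<Union>m. Lim_tree (S m))" by blast
  have "narrow f (Lim_tree (S m))" for m
    using S(1)[of m] card_restr_Lim_tree le_trans unfolding narrow_def of_width_def by blast
  thus "narrowly_covered f X"
    using S(2) unfolding narrowly_covered_def by (intro exI[of _ "\<lambda>m. Lim_tree (S m)"]) simp
qed

text \<open>
  A finite modification \<open>x\<close> of a point of \<open>Y m\<close> is sorted by a level \<open>k\<close> from which on \<open>x\<close> is unmodified
  and \<open>Y m\<close> obeys the bound, and by its stem up to \<open>k\<close>. Up to level \<open>k\<close> such a class has one initial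
  segment, and beyond it at most as many as \<open>Y m\<close>.
\<close>

lemma narrowly_covered_if_almost_narrow:
  fixes Y :: "nat \<Rightarrow> cantor set"
  assumes f: "corset f" and Y: "\<And>m. \<forall>\<^sub>F n in sequentially. card (restr {..<n} ` Y m) \<le> f n"
    and X: "X \<subseteq> (\<Union>m. fin_closure (Y m))"
  shows "narrowly_covered f X"
proof -
  define W where "W = (\<lambda>(m, k, v). {x. restr {..<k} x = v \<and> (\<exists>y\<in>Y m. \<forall>i\<ge>k. x i = y i)})"
  define I where "I = {(m, k, v). v \<in> cube {..<k} \<and> (\<forall>n\<ge>k. card (restr {..<n} ` Y m) \<le> f n)}"
  show ?thesis
  proof (rule narrowly_coveredI)
    have "I \<subseteq> UNIV \<times> UNIV \<times> (\<Union>n. cube {..<n})" by (auto simp: I_def)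
    hence "countable I"
      by (rule countable_subset) (intro countable_SIGMA countable_finite_support, auto)
    thus "countable (W ` I)" by simp
    show "X \<subseteq> \<Union>(W ` I)"
    proof
      fix x assume "x \<in> X"
      then obtain m y where y: "y \<in> Y m" "\<forall>\<^sub>\<infinity>n. y n = x n"
        using X by (auto simp: fin_closure_def)
      then obtain a where a: "\<And>i. i \<ge> a \<Longrightarrow> y i = x i" by (auto simp: MOST_nat_le)
      obtain b where b: "\<And>n. n \<ge> b \<Longrightarrow> card (restr {..<n} ` Y m) \<le> f n"
        using Y[of m] by (auto simp: eventually_sequentially)
      define k where "k = max a b"
      have "(m, k, restr {..<k} x) \<in> I" using b by (auto simp: I_def k_def)
      moreover have "x \<in> W (m, k, restr {..<k} x)"
        using y(1) a by (auto simp: W_def k_def intro!: bexI[of _ y])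
      ultimately show "x \<in> \<Union>(W ` I)" by blast
    qed
    fix Z assume "Z \<in> W ` I"
    then obtain m k v where Z: "Z = W (m, k, v)"
      and v: "\<And>n. n \<ge> k \<Longrightarrow> card (restr {..<n} ` Y m) \<le> f n" by (auto simp: I_def)
    show "narrow f Z"
      unfolding narrow_def
    proof
      fix n
      show "card (restr {..<n} ` Z) \<le> f n"
      proof (cases "n \<le> k")
        case True
        have "restr {..<n} ` Z \<subseteq> {restr {..<n} v}"
          using restr_restr_lessThan[OF True] by (auto simp: Z W_def)
        hence "card (restr {..<n} ` Z) \<le> 1" using card_mono[of "{restr {..<n} v}"] by fastforce
        also have "1 \<le> f n" using f by (simp add: corset_def Suc_le_eq)
        finally show ?thesis .
      next
        case False
        have "restr {..<n} ` Z \<subseteq> (\<lambda>u i. if i < k then v i else u i) ` restr {..<n} ` Y m"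
        proof
          fix u assume "u \<in> restr {..<n} ` Z"
          then obtain x y where u: "u = restr {..<n} x" "restr {..<k} x = v" "y \<in> Y m" "\<And>i. i \<ge> k \<Longrightarrow> x i = y i"
            by (auto simp: Z W_def)
          have "u = (\<lambda>i. if i < k then v i else restr {..<n} y i)"
            using False u(4) unfolding u(1) u(2)[symmetric] by (auto simp: fun_eq_iff restr_def)
          thus "u \<in> (\<lambda>u i. if i < k then v i else u i) ` restr {..<n} ` Y m" using u(3) by blast
        qed
        hence "card (restr {..<n} ` Z) \<le> card ((\<lambda>u i. if i < k then v i else u i) ` restr {..<n} ` Y m)"
          by (intro card_mono finite_imageI finite_restr_image) auto
        also have "\<dots> \<le> card (restr {..<n} ` Y m)"
          by (rule card_image_le) (simp add: finite_restr_image)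
        also have "\<dots> \<le> f n" using v False by simp
        finally show ?thesis .
      qed
    qed
  qed
qed

text \<open>
  Let \<open>r n\<close> be the integer square root of \<open>f n - 1\<close> and cover \<open>X\<close> by sets \<open>Y m\<close> that are narrow for
  \<open>g = max 1 r\<close>. The coordinates \<open>i\<close> with \<open>r i \<le> m\<close>, which are finitely many, are set to zero in \<open>Y m\<close>.
  Then at level \<open>n\<close> only the sets with \<open>m < r n\<close> are visible, each with at most \<open>r n\<close> initial
  segments, besides the zero segment: together at most \<open>(r n)\<^sup>2 + 1 \<le> f n\<close>.
\<close>

lemma narrow_fin_closure_if_narrowly_covered:
  assumes cov: "\<And>g. corset g \<Longrightarrow> narrowly_covered g X" and f: "corset f"
  shows "\<exists>Y. narrow f Y \<and> X \<subseteq> fin_closure Y"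
proof -
  define r where "r n = floor_sqrt (f n - 1)" for n
  define g where "g n = max 1 (r n)" for n
  have r: "r n * r n + 1 \<le> f n" for n
  proof -
    have "(r n)\<^sup>2 \<le> f n - 1" unfolding r_def by (rule floor_sqrt_power2_le)
    moreover have "f n \<noteq> 0" using f by (simp add: corset_def)
    ultimately show ?thesis by (simp add: power2_eq_square)
  qed
  have mono_r: "r m \<le> r n" if "m \<le> n" for m n
    using f that unfolding r_def corset_def by (intro monoD[OF mono_floor_sqrt] diff_le_mono) (auto dest: monoD)
  have large_r: "\<forall>\<^sub>F n in sequentially. b \<le> r n" for b
  proof -
    have "\<forall>\<^sub>F n in sequentially. b\<^sup>2 + 1 \<le> f n"
      using f by (simp add: corset_def filterlim_at_top)
    thus ?thesis
    proof eventually_elim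
      case (elim n)
      hence "b\<^sup>2 \<le> f n - 1" by simp
      thus ?case unfolding r_def by (simp add: le_floor_sqrt_iff)
    qed
  qed
  have "corset g"
    unfolding corset_def
  proof (intro conjI)
    show "mono g" unfolding g_def by (intro monoI max.mono mono_r) auto
    show "filterlim g at_top at_top"
      unfolding filterlim_at_top g_def
    proof
      fix b show "\<forall>\<^sub>F n in sequentially. b \<le> max 1 (r n)"
        using large_r[of b] by eventually_elim simp
    qed
  qed (auto simp: g_def)
  from cov[OF this] obtain Y :: "nat \<Rightarrow> cantor set"
    where Y: "\<And>m. narrow g (Y m)" "X \<subseteq> (\<Union>m. Y m)"
    unfolding narrowly_covered_def by blast
  define cut where "cut m y = (\<lambda>i. if m < r i then y i else 0 :: bit)" for m and y :: cantor
  define Z where "Z = insert 0 (\<Union>m. cut m ` Y m)"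
  have "narrow f Z"
    unfolding narrow_def
  proof
    fix n
    have "restr {..<n} ` Z \<subseteq> insert 0 (\<Union>m<r n. restr {..<n} ` cut m ` Y m)"
    proof
      fix u assume "u \<in> restr {..<n} ` Z"
      then consider "u = restr {..<n} 0" | m y where "u = restr {..<n} (cut m y)" "y \<in> Y m"
        by (auto simp: Z_def)
      thus "u \<in> insert 0 (\<Union>m<r n. restr {..<n} ` cut m ` Y m)"
      proof cases
        case 1
        thus ?thesis by (simp add: restr_def fun_eq_iff)
      next
        case 2
        show ?thesis
        proof (cases "m < r n")
          case True
          thus ?thesis using 2 by blast
        next
          case False
          have "\<not> m < r i" if "i < n" for i using False mono_r[of i n] that by simp
          hence "u = 0" using 2(1) by (auto simp: restr_def cut_def fun_eq_iff)
          thus ?thesis by simp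
        qed
      qed
    qed
    hence "card (restr {..<n} ` Z) \<le> card (insert 0 (\<Union>m<r n. restr {..<n} ` cut m ` Y m))"
      by (intro card_mono) (auto intro: finite_restr_image)
    also have "\<dots> \<le> Suc (card (\<Union>m<r n. restr {..<n} ` cut m ` Y m))" by (rule card_insert_le_m1) auto
    also have "\<dots> \<le> Suc (\<Sum>m<r n. card (restr {..<n} ` cut m ` Y m))"
      using card_UN_le[of "{..<r n}"] by simp
    also have "\<dots> \<le> Suc (\<Sum>m<r n. g n)"
    proof (intro Suc_le_mono[THEN iffD2] sum_mono)
      fix m
      have "restr {..<n} ` cut m ` Y m = cut m ` restr {..<n} ` Y m"
        unfolding image_image by (intro image_cong) (auto simp: restr_def cut_def fun_eq_iff)
      hence "card (restr {..<n} ` cut m ` Y m) \<le> card (restr {..<n} ` Y m)"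
        by (simp add: card_image_le finite_restr_image)
      also have "\<dots> \<le> g n" using Y(1) by (simp add: narrow_def)
      finally show "card (restr {..<n} ` cut m ` Y m) \<le> g n" .
    qed
    also have "\<dots> \<le> r n * r n + 1" by (cases "r n = 0") (auto simp: g_def max_def)
    also have "\<dots> \<le> f n" by (rule r)
    finally show "card (restr {..<n} ` Z) \<le> f n" .
  qed
  moreover have "X \<subseteq> fin_closure Z"
  proof
    fix x assume "x \<in> X"
    then obtain m where m: "x \<in> Y m" using Y(2) by blast
    have "\<forall>\<^sub>F n in sequentially. cut m x n = x n"
      using large_r[of "Suc m"] by eventually_elim (simp add: cut_def)
    thus "x \<in> fin_closure Z"
      using m by (auto simp: fin_closure_def Z_def cofinite_eq_sequentially)
  qed
  ultimately show ?thesis by blast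
qed

theorem theorem13:
  fixes X :: "(nat \<Rightarrow> bit) set"
  shows
    "(null_additive X \<longleftrightarrow>
       (\<forall>f. corset f \<longrightarrow>
         (\<exists>S. tree S \<and> of_width S f \<and> X \<subseteq> fin_closure (Lim_tree S)))) \<and>
     (null_additive X \<longleftrightarrow>
       (\<forall>f. corset f \<longrightarrow>
         (\<exists>S :: nat \<Rightarrow> bit list set.
            (\<forall>m. tree (S m) \<and> almost_of_width (S m) f) \<and>
            X \<subseteq> (\<Union>m. fin_closure (Lim_tree (S m)))))) \<and>
     (null_additive X \<longleftrightarrow>
       (\<forall>f. corset f \<longrightarrow>
         (\<exists>S :: nat \<Rightarrow> bit list set.
            (\<forall>m. tree (S m) \<and> of_width (S m) f) \<and>
            X \<subseteq> (\<Union>m. Lim_tree (S m)))))"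
    (is "(?a \<longleftrightarrow> ?b) \<and> (?a \<longleftrightarrow> ?c) \<and> (?a \<longleftrightarrow> ?d)")
proof -
  let ?covered = "\<forall>f. corset f \<longrightarrow> narrowly_covered f X"
  have d: "?d \<longleftrightarrow> ?covered" using narrowly_covered_iff_trees by blast
  have "?a \<longleftrightarrow> ?covered"
    using narrowly_covered_if_null_additive null_additive_if_narrowly_covered by blast
  moreover have ?b if ?covered
  proof (intro allI impI)
    fix f assume f: "corset f"
    obtain Y where Y: "narrow f Y" "X \<subseteq> fin_closure Y"
      using narrow_fin_closure_if_narrowly_covered[OF _ f] \<open>?covered\<close> by blast
    obtain S where S: "tree S" "of_width S f" "Y \<subseteq> Lim_tree S"
      using narrow_subset_Lim_tree[OF f Y(1)] by blast
    have "fin_closure Y \<subseteq> fin_closure (Lim_tree S)" using S(3) by (auto simp: fin_closure_def)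
    thus "\<exists>S. tree S \<and> of_width S f \<and> X \<subseteq> fin_closure (Lim_tree S)" using S Y(2) by blast
  qed
  moreover have ?c if ?b
  proof (intro allI impI)
    fix f assume "corset f"
    then obtain S where S: "tree S" "of_width S f" "X \<subseteq> fin_closure (Lim_tree S)"
      using \<open>?b\<close> by blast
    have "almost_of_width S f" using S(2) by (simp add: almost_of_width_def of_width_def)
    thus "\<exists>S :: nat \<Rightarrow> bit list set. (\<forall>m. tree (S m) \<and> almost_of_width (S m) f) \<and>
            X \<subseteq> (\<Union>m. fin_closure (Lim_tree (S m)))"
      using S by (intro exI[of _ "\<lambda>_. S"]) auto
  qed
  moreover have ?covered if ?c
  proof (intro allI impI)
    fix f assume f: "corset f"
    from \<open>?c\<close>[rule_format, OF f] obtain S :: "nat \<Rightarrow> bit list set"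
      where S: "\<And>m. almost_of_width (S m) f" and X: "X \<subseteq> (\<Union>m. fin_closure (Lim_tree (S m)))"
      by blast
    have "\<forall>\<^sub>F n in sequentially. card (restr {..<n} ` Lim_tree (S m)) \<le> f n" for m
      using S[of m] unfolding almost_of_width_def
      by eventually_elim (rule le_trans[OF card_restr_Lim_tree])
    thus "narrowly_covered f X" using f X by (intro narrowly_covered_if_almost_narrow)
  qed
  ultimately show ?thesis using d by argo
qed

end
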